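(* \begin{align*} \mathrm{VConv}(U,F)=\bigoplus_{k=0}^n\mathrm{VConv}_k(U,F) \end{align*}
   Context: $F$ is a locally convex vector space, $U\subset\mathbb{R}^n$ an open convex set, $\mathrm{Conv}(U,\mathbb{R})$ the space of finite-valued convex functions on $U$ with the topology of uniform convergence on compact subsets. $\mathrm{VConv}(U,F)$ is the space of all continuous valuations $\mu:\mathrm{Conv}(U,\mathbb{R})\to F$ that are dually epi-translation invariant, i.e. $\mu(f+l)=\mu(f)$ for all affine $l:\mathbb{R}^n\to\mathbb{R}$; $\mathrm{VConv}_k(U,F)$ is the subspace of $k$-homogeneous ones, i.e. $\mu(tf)=t^k\mu(f)$ for all $t\ge0$. *)

theory Defs
  imports "HOL-Analysis.Analysis"
begin

text \<open>A (Hausdorff, via the class t2_space) locally convex topological vector space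
  structure on the type 'b: addition and scalar multiplication are continuous and every
  point has a neighbourhood basis of convex open sets.\<close>
definition locally_convex_tvs :: "'b::{real_vector,topological_space} itself \<Rightarrow> bool" where
  "locally_convex_tvs _ \<longleftrightarrow>
     continuous_on UNIV (\<lambda>(x::'b, y::'b). x + y) \<and>
     continuous_on UNIV (\<lambda>(t::real, x::'b). t *\<^sub>R x) \<and>
     (\<forall>(x::'b) W. open W \<and> x \<in> W \<longrightarrow> (\<exists>C. open C \<and> convex C \<and> x \<in> C \<and> C \<subseteq> W))"

text \<open>Elements of Conv(U,R) are represented by functions f with convex_on U f
  (only the values on U matter).  Affine functions on the ambient space.\<close>
definition affine_fun :: "('a::euclidean_space \<Rightarrow> real) \<Rightarrow> bool" where
  "affine_fun l \<longleftrightarrow> (\<exists>L c. linear L \<and> (\<forall>x. l x = L x + c))"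

definition conv_continuous ::
  "'a::euclidean_space set \<Rightarrow> (('a \<Rightarrow> real) \<Rightarrow> 'b::topological_space) \<Rightarrow> bool" where
  "conv_continuous U \<mu> \<longleftrightarrow>
     (\<forall>f W. convex_on U f \<and> open W \<and> \<mu> f \<in> W \<longrightarrow>
        (\<exists>K e. compact K \<and> K \<subseteq> U \<and> e > 0 \<and>
           (\<forall>g. convex_on U g \<and> (\<forall>x\<in>K. \<bar>g x - f x\<bar> < e) \<longrightarrow> \<mu> g \<in> W)))"

definition is_valuation ::
  "'a::euclidean_space set \<Rightarrow> (('a \<Rightarrow> real) \<Rightarrow> 'b::real_vector) \<Rightarrow> bool" where
  "is_valuation U \<mu> \<longleftrightarrow>
     (\<forall>f g. convex_on U f \<and> convex_on U g \<and> convex_on U (\<lambda>x. min (f x) (g x)) \<longrightarrow>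
        \<mu> (\<lambda>x. max (f x) (g x)) + \<mu> (\<lambda>x. min (f x) (g x)) = \<mu> f + \<mu> g)"

definition dually_epi_translation_invariant ::
  "'a::euclidean_space set \<Rightarrow> (('a \<Rightarrow> real) \<Rightarrow> 'b) \<Rightarrow> bool" where
  "dually_epi_translation_invariant U \<mu> \<longleftrightarrow>
     (\<forall>f l. convex_on U f \<and> affine_fun l \<longrightarrow> \<mu> (\<lambda>x. f x + l x) = \<mu> f)"

definition VConv ::
  "'a::euclidean_space set \<Rightarrow> (('a \<Rightarrow> real) \<Rightarrow> 'b::{real_vector,topological_space}) set" where
  "VConv U = {\<mu>. is_valuation U \<mu> \<and> conv_continuous U \<mu> \<and> dually_epi_translation_invariant U \<mu>}"

definition VConv_hom ::
  "'a::euclidean_space set \<Rightarrow> nat \<Rightarrow> (('a \<Rightarrow> real) \<Rightarrow> 'b::{real_vector,topological_space}) set" where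
  "VConv_hom U k = {\<mu> \<in> VConv U.
     \<forall>f t. convex_on U f \<and> t \<ge> 0 \<longrightarrow> \<mu> (\<lambda>x. t * f x) = (t ^ k) *\<^sub>R \<mu> f}"

end

theory Submission
  imports Defs "HOL-Computational_Algebra.Polynomial"
begin

text \<open>
  It suffices that \<open>t \<mapsto> \<mu> (t f)\<close> is a polynomial of degree at most \<open>n\<close> on \<open>t \<ge> 0\<close>; the
  components are then \<open>\<nu>\<^sub>k f = \<Sum>j\<le>n. a k j \<mu> (j f)\<close> with the inverse Vandermonde matrix \<open>a\<close>.
  By continuity one may take \<open>f\<close> to be a maximum of finitely many affine functions.

  If there are more than \<open>n + 1\<close> of them, their gradients are affinely dependent. The dependency
  splits them into two groups with a weighted mean of the first below the maximum of the second,
  and the valuation property then writes \<open>\<mu> (t f)\<close> as an alternating sum of values at maxima of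
  fewer functions.

  For \<open>f = max (\<sigma>\<^sub>0, \<dots>, \<sigma>\<^sub>m)\<close>, dual to a simplex, the classical dissection of a dilated simplex
  into products of two smaller ones expresses \<open>\<mu> (g + (t + u) f) - \<mu> (g + t f)\<close> through terms
  \<open>\<mu> (g' + t max (\<sigma>\<^sub>0, \<dots>, \<sigma>\<^sub>j))\<close> with \<open>j < m\<close>. Inductively all \<open>(m + 1)\<close>-fold differences vanish.
\<close>

section \<open>Functions with vanishing iterated differences\<close>

text \<open>Frechet's description of polynomials of degree less than \<open>m\<close>, with the
  steps chosen independently. Arguments and steps are nonnegative because \<open>\<mu> (t f)\<close>
  is only meaningful for \<open>t \<ge> 0\<close>. No regularity is built in, so that the condition
  passes to pointwise limits.\<close>

fun differences_vanish :: "nat \<Rightarrow> (real \<Rightarrow> 'b::real_vector) \<Rightarrow> bool" where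
  "differences_vanish 0 \<phi> \<longleftrightarrow> (\<forall>t\<ge>0. \<phi> t = 0)"
| "differences_vanish (Suc m) \<phi> \<longleftrightarrow> (\<forall>u\<ge>0. differences_vanish m (\<lambda>t. \<phi> (t + u) - \<phi> t))"

lemma differences_vanish_cong:
  assumes "differences_vanish m \<phi>" "\<And>t. t \<ge> 0 \<Longrightarrow> \<psi> t = \<phi> t"
  shows "differences_vanish m \<psi>"
  using assms
proof (induction m arbitrary: \<phi> \<psi>)
  case 0
  have "\<psi> t = 0" if "t \<ge> 0" for t
    using 0(1) 0(2)[OF that] that unfolding differences_vanish.simps by metis
  then show ?case by simp
next
  case (Suc m)
  have "differences_vanish m (\<lambda>t. \<psi> (t + u) - \<psi> t)" if u: "u \<ge> 0" for u
  proof (rule Suc.IH)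
    show "differences_vanish m (\<lambda>t. \<phi> (t + u) - \<phi> t)"
      using Suc.prems(1) u by simp
    show "\<psi> (t + u) - \<psi> t = \<phi> (t + u) - \<phi> t" if "t \<ge> 0" for t
      using Suc.prems(2)[of t] Suc.prems(2)[of "t + u"] that u by (metis add_nonneg_nonneg)
  qed
  then show ?case by simp
qed

lemma differences_vanish_zero: "differences_vanish m (\<lambda>t. 0)"
  by (induction m) auto

lemma differences_vanish_add:
  "differences_vanish m \<phi> \<Longrightarrow> differences_vanish m \<psi> \<Longrightarrow> differences_vanish m (\<lambda>t. \<phi> t + \<psi> t)"
proof (induction m arbitrary: \<phi> \<psi>)
  case (Suc m)
  have "differences_vanish m (\<lambda>t. (\<phi> (t + u) + \<psi> (t + u)) - (\<phi> t + \<psi> t))" if "u \<ge> 0" for u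
  proof -
    have "differences_vanish m (\<lambda>t. (\<phi> (t + u) - \<phi> t) + (\<psi> (t + u) - \<psi> t))"
      using Suc.prems that by (intro Suc.IH) auto
    then show ?thesis by (rule differences_vanish_cong) simp
  qed
  then show ?case by simp
qed simp

lemma differences_vanish_diff:
  "differences_vanish m \<phi> \<Longrightarrow> differences_vanish m \<psi> \<Longrightarrow> differences_vanish m (\<lambda>t. \<phi> t - \<psi> t)"
proof (induction m arbitrary: \<phi> \<psi>)
  case (Suc m)
  have "differences_vanish m (\<lambda>t. (\<phi> (t + u) - \<psi> (t + u)) - (\<phi> t - \<psi> t))" if "u \<ge> 0" for u
  proof -
    have "differences_vanish m (\<lambda>t. (\<phi> (t + u) - \<phi> t) - (\<psi> (t + u) - \<psi> t))"
      using Suc.prems that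
      by (intro Suc.IH[of "\<lambda>t. \<phi> (t + u) - \<phi> t" "\<lambda>t. \<psi> (t + u) - \<psi> t"]) auto
    then show ?thesis by (rule differences_vanish_cong) simp
  qed
  then show ?case by simp
qed simp

lemma differences_vanish_sum:
  "(\<And>i. i \<in> I \<Longrightarrow> differences_vanish m (\<phi> i)) \<Longrightarrow> differences_vanish m (\<lambda>t. \<Sum>i\<in>I. \<phi> i t)"
  by (induction I rule: infinite_finite_induct)
     (simp_all add: differences_vanish_zero differences_vanish_add del: differences_vanish.simps)

lemma differences_vanish_Suc: "differences_vanish m \<phi> \<Longrightarrow> differences_vanish (Suc m) \<phi>"
proof (induction m arbitrary: \<phi>)
  case 0
  then show ?case by (intro differences_vanish.simps(2)[THEN iffD2] allI impI) auto
next
  case (Suc m)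
  then have "differences_vanish (Suc m) (\<lambda>t. \<phi> (t + u) - \<phi> t)" if "u \<ge> 0" for u
    using that by (intro Suc.IH) simp
  then show ?case unfolding differences_vanish.simps(2)[of "Suc m"] by blast
qed

lemma differences_vanish_mono:
  "m \<le> n \<Longrightarrow> differences_vanish m \<phi> \<Longrightarrow> differences_vanish n \<phi>"
proof (induction n rule: dec_induct)
  case (step k)
  then show ?case by (intro differences_vanish_Suc) 
qed

text \<open>Newton's forward difference formula on the progression \<open>0, u, 2 u, ...\<close>:
  the formula for the first difference is summed up with Pascal's rule.\<close>

lemma differences_vanish_newton:
  assumes "differences_vanish m \<phi>" "u \<ge> 0"
  shows "\<exists>c. \<forall>k::nat. \<phi> (of_nat k * u) = (\<Sum>i<m. of_nat (k choose i) *\<^sub>R c i)"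
  using assms(1)
proof (induction m arbitrary: \<phi>)
  case 0
  then show ?case using assms(2) by simp
next
  case (Suc m)
  then have "differences_vanish m (\<lambda>t. \<phi> (t + u) - \<phi> t)"
    using assms(2) by simp
  from Suc.IH[OF this] obtain c where
    c: "\<phi> (of_nat k * u + u) - \<phi> (of_nat k * u) = (\<Sum>i<m. of_nat (k choose i) *\<^sub>R c i)" for k
    by blast
  \<comment> \<open>The \<open>i\<close>-th difference of the first difference is the
    \<open>(i + 1)\<close>-st difference of \<open>\<phi>\<close>, so the coefficients shift by one
    and \<open>\<phi> 0\<close> enters in front.\<close>
  define d where "d i = (case i of 0 \<Rightarrow> \<phi> 0 | Suc i \<Rightarrow> c i)" for i
  have "\<phi> (of_nat k * u) = (\<Sum>i<Suc m. of_nat (k choose i) *\<^sub>R d i)" for k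
  proof (induction k)
    case 0
    have "(\<Sum>i<Suc m. of_nat (0 choose i) *\<^sub>R d i) = d 0"
      by (subst sum.lessThan_Suc_shift) simp
    then show ?case by (simp add: d_def)
  next
    case (Suc k)
    have "\<phi> (of_nat (Suc k) * u) = \<phi> (of_nat k * u) + (\<Sum>i<m. of_nat (k choose i) *\<^sub>R c i)"
      using c[of k] by (simp add: algebra_simps)
    also have "\<dots> = d 0 + (\<Sum>i<m. of_nat (k choose Suc i) *\<^sub>R d (Suc i))
        + (\<Sum>i<m. of_nat (k choose i) *\<^sub>R d (Suc i))"
      unfolding Suc.IH by (subst sum.lessThan_Suc_shift) (simp add: d_def)
    also have "\<dots> = (\<Sum>i<Suc m. of_nat (Suc k choose i) *\<^sub>R d i)"
      by (subst sum.lessThan_Suc_shift) (simp add: sum.distrib scaleR_add_left)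
    finally show ?case .
  qed
  then show ?case by blast
qed

section \<open>Polynomial interpolation at the nodes \<open>0, ..., n\<close>\<close>

text \<open>\<open>a k j\<close> is the coefficient of \<open>X ^ k\<close> in the Lagrange
  polynomial of the node \<open>j\<close>. Interpolating \<open>X ^ i\<close> with
  \<open>i \<le> n\<close> at \<open>n + 1\<close> nodes returns \<open>X ^ i\<close>; comparing
  coefficients gives the claim. The node \<open>0\<close> relies on
  \<open>0 ^ 0 = 1\<close>.\<close>

lemma inverse_vandermonde:
  "\<exists>a. \<forall>i\<le>n. \<forall>k\<le>n. (\<Sum>j\<le>n. a k j * real j ^ i) = (if i = k then 1 else 0)"
proof -
  define D where "D j = (\<Prod>i\<in>{..n}-{j}. real j - real i)" for j
  define L where "L j = smult (1 / D j) (\<Prod>i\<in>{..n}-{j}. [:- real i, 1:])" for j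
  have D: "D j \<noteq> 0" for j
    unfolding D_def by (auto simp: prod_zero_iff)
  have Lj: "poly (L j) (real i) = (if i = j then 1 else 0)" if "i \<le> n" for i j
    using that D[of j] unfolding L_def
    by (auto simp: poly_prod D_def prod_zero_iff)
  have "degree (L j) \<le> n" if "j \<le> n" for j
  proof -
    have "degree (\<Prod>i\<in>{..n}-{j}. [:- real i, 1:]) \<le> (\<Sum>i\<in>{..n}-{j}. 1)"
      by (rule order_trans[OF degree_prod_sum_le]) auto
    also have "\<dots> = n" using that by simp
    finally show ?thesis unfolding L_def by simp
  qed
  note deg = this
  have "(\<Sum>j\<le>n. coeff (L j) k * real j ^ i) = (if i = k then 1 else 0)" if "i \<le> n" for i k
  proof -
    have "monom 1 i = (\<Sum>j\<le>n. smult (real j ^ i) (L j))"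
    proof (rule poly_eqI_degree[where A = "real ` {..n}"])
      fix x assume "x \<in> real ` {..n}"
      then obtain l where l: "l \<le> n" "x = real l" by auto
      have "(\<Sum>j\<le>n. real j ^ i * (if l = j then 1 else 0)) = real l ^ i"
        using l(1) by (simp add: if_distrib sum.delta cong: if_cong)
      then show "poly (monom 1 i) x = poly (\<Sum>j\<le>n. smult (real j ^ i) (L j)) x"
        using l Lj by (simp add: poly_sum poly_monom)
    next
      have "card (real ` {..n}) = Suc n" by (subst card_image) auto
      moreover have "degree (\<Sum>j\<le>n. smult (real j ^ i) (L j)) \<le> n"
        by (rule degree_sum_le) (use deg degree_smult_le order_trans in \<open>auto intro: order_trans\<close>)
      ultimately show "degree (monom (1::real) i) < card (real ` {..n})"
        "degree (\<Sum>j\<le>n. smult (real j ^ i) (L j)) < card (real ` {..n})"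
        using that by (auto simp: degree_monom_eq)
    qed
    then have "coeff (monom 1 i) k = coeff (\<Sum>j\<le>n. smult (real j ^ i) (L j)) k" by simp
    then show ?thesis by (simp add: coeff_sum mult.commute eq_commute)
  qed
  then show ?thesis by (intro exI[of _ "\<lambda>k j. coeff (L j) k"]) auto
qed

lemma vandermonde_interpolation:
  fixes a :: "nat \<Rightarrow> nat \<Rightarrow> real"
  assumes a: "\<forall>i\<le>n. \<forall>k\<le>n. (\<Sum>j\<le>n. a k j * real j ^ i) = (if i = k then 1 else 0)"
    and "degree p \<le> n" "k \<le> n"
  shows "(\<Sum>j\<le>n. a k j * poly p (real j)) = coeff p k"
proof -
  have "poly p x = (\<Sum>i\<le>n. coeff p i * x ^ i)" for x
    using assms(2) unfolding poly_altdef
    by (intro sum.mono_neutral_left) (auto simp: coeff_eq_0)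
  then have "(\<Sum>j\<le>n. a k j * poly p (real j)) = (\<Sum>j\<le>n. \<Sum>i\<le>n. coeff p i * (a k j * real j ^ i))"
    by (simp add: sum_distrib_left algebra_simps)
  also have "\<dots> = (\<Sum>i\<le>n. coeff p i * (\<Sum>j\<le>n. a k j * real j ^ i))"
    by (subst sum.swap) (simp add: sum_distrib_left)
  also have "\<dots> = (\<Sum>i\<le>n. coeff p i * (if i = k then 1 else 0))"
    using a assms(3) by simp
  also have "\<dots> = coeff p k"
    using assms(3) by (simp add: if_distrib sum.delta cong: if_cong)
  finally show ?thesis .
qed

text \<open>The form in which \<open>a\<close> is applied to valuations: it yields both the
  homogeneity of the components and their uniqueness.\<close>

lemma vandermonde_recover:
  fixes c :: "nat \<Rightarrow> 'b::real_vector"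
  assumes a: "\<forall>i\<le>n. \<forall>k\<le>n. (\<Sum>j\<le>n. a k j * real j ^ i) = (if i = k then 1 else 0)"
    and "k \<le> n"
  shows "(\<Sum>j\<le>n. a k j *\<^sub>R (\<Sum>i\<le>n. (real j ^ i) *\<^sub>R c i)) = c k"
proof -
  have "(\<Sum>j\<le>n. a k j *\<^sub>R (\<Sum>i\<le>n. (real j ^ i) *\<^sub>R c i))
      = (\<Sum>i\<le>n. (\<Sum>j\<le>n. a k j * real j ^ i) *\<^sub>R c i)"
    by (simp add: scaleR_sum_right scaleR_sum_left) (rule sum.swap)
  also have "\<dots> = (\<Sum>i\<le>n. if i = k then c i else 0)"
    using assms by (intro sum.cong) auto
  also have "\<dots> = c k" using assms(2) by simp
  finally show ?thesis .
qed

text \<open>The point \<open>p / q\<close> and the integers \<open>j = (j q) / q\<close> lie on one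
  progression with step \<open>1 / q\<close>, so a single Newton polynomial describes
  \<open>\<phi>\<close> at all of them, and \<open>a\<close> reads off its coefficients from the
  integers. These coefficients no longer involve \<open>q\<close>, which later allows the passage to
  real arguments.\<close>

lemma differences_vanish_rational:
  fixes \<phi> :: "real \<Rightarrow> 'b::real_vector"
  assumes a: "\<forall>i\<le>n. \<forall>k\<le>n. (\<Sum>j\<le>n. a k j * real j ^ i) = (if i = k then 1 else 0)"
    and \<phi>: "differences_vanish (Suc n) \<phi>" and "q > 0"
  shows "\<phi> (real p / real q) = (\<Sum>k\<le>n. (real p / real q) ^ k *\<^sub>R (\<Sum>j\<le>n. a k j *\<^sub>R \<phi> (real j)))"
proof -
  obtain c where c: "\<phi> (of_nat k * (1 / real q)) = (\<Sum>i<Suc n. of_nat (k choose i) *\<^sub>R c i)" for k :: nat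
    using differences_vanish_newton[OF \<phi>, of "1 / real q"] by auto
  \<comment> \<open>\<open>b i\<close> is the binomial coefficient \<open>q x\<close> over
    \<open>i\<close> as a polynomial in \<open>x\<close>; it turns the Newton expansion in
    \<open>m\<close> into a polynomial in \<open>m / q\<close>.\<close>
  define b where "b i = smult (1 / fact i) (\<Prod>j\<in>{0..<i}. [:- real j, real q:])" for i
  have b: "poly (b i) (real m / real q) = of_nat (m choose i)" for i m
    using \<open>q > 0\<close> unfolding b_def
    by (simp add: poly_prod binomial_gbinomial gbinomial_prod_rev)
  have deg: "degree (b i) \<le> n" if "i \<le> n" for i
  proof -
    have "degree (\<Prod>j\<in>{0..<i}. [:- real j, real q:]) \<le> (\<Sum>j\<in>{0..<i}. 1)"
      by (rule order_trans[OF degree_prod_sum_le]) (auto intro!: sum_mono)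
    then show ?thesis using that unfolding b_def by simp
  qed
  have \<phi>b: "\<phi> (real m / real q) = (\<Sum>i\<le>n. poly (b i) (real m / real q) *\<^sub>R c i)" for m
    using c[of m] by (simp add: b lessThan_Suc_atMost)
  have \<phi>j: "\<phi> (real j) = (\<Sum>i\<le>n. poly (b i) (real j) *\<^sub>R c i)" for j
    using \<phi>b[of "j * q"] \<open>q > 0\<close> by simp
  have d: "(\<Sum>j\<le>n. a k j *\<^sub>R \<phi> (real j)) = (\<Sum>i\<le>n. coeff (b i) k *\<^sub>R c i)" if "k \<le> n" for k
  proof -
    have "(\<Sum>j\<le>n. a k j *\<^sub>R \<phi> (real j)) = (\<Sum>j\<le>n. \<Sum>i\<le>n. (a k j * poly (b i) (real j)) *\<^sub>R c i)"
      by (simp add: \<phi>j scaleR_sum_right)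
    also have "\<dots> = (\<Sum>i\<le>n. (\<Sum>j\<le>n. a k j * poly (b i) (real j)) *\<^sub>R c i)"
      by (subst sum.swap) (simp add: scaleR_sum_left)
    finally show ?thesis
      using vandermonde_interpolation[OF a deg that] by simp
  qed
  have "(\<Sum>k\<le>n. (real p / real q) ^ k *\<^sub>R (\<Sum>j\<le>n. a k j *\<^sub>R \<phi> (real j)))
      = (\<Sum>k\<le>n. \<Sum>i\<le>n. (coeff (b i) k * (real p / real q) ^ k) *\<^sub>R c i)"
    by (simp add: d scaleR_sum_right mult.commute)
  also have "\<dots> = (\<Sum>i\<le>n. (\<Sum>k\<le>n. coeff (b i) k * (real p / real q) ^ k) *\<^sub>R c i)"
    by (subst sum.swap) (simp add: scaleR_sum_left)
  also have "\<dots> = (\<Sum>i\<le>n. poly (b i) (real p / real q) *\<^sub>R c i)"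
  proof (intro sum.cong refl arg_cong2[where f = scaleR])
    fix i assume "i \<in> {..n}"
    then show "(\<Sum>k\<le>n. coeff (b i) k * (real p / real q) ^ k) = poly (b i) (real p / real q)"
      using deg[of i] unfolding poly_altdef
      by (intro sum.mono_neutral_right) (auto simp: coeff_eq_0)
  qed
  finally show ?thesis using \<phi>b by simp
qed

section \<open>Dissection of piecewise affine functions\<close>

text \<open>An indexed family serves the dissection, where the order of the functions matters;
  elsewhere a set of functions is its own index set, with \<open>F\<close> the identity.\<close>

definition upper_envelope :: "('i \<Rightarrow> 'a \<Rightarrow> real) \<Rightarrow> 'i set \<Rightarrow> 'a \<Rightarrow> real" where
  "upper_envelope F I x = Max ((\<lambda>i. F i x) ` I)"

lemma upper_envelope_insert:
  "finite I \<Longrightarrow> I \<noteq> {} \<Longrightarrow> upper_envelope F (insert i I) x = max (F i x) (upper_envelope F I x)"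
  by (simp add: upper_envelope_def)

lemma upper_envelope_ge: "finite I \<Longrightarrow> i \<in> I \<Longrightarrow> F i x \<le> upper_envelope F I x"
  by (simp add: upper_envelope_def)

lemma upper_envelope_le:
  "finite I \<Longrightarrow> I \<noteq> {} \<Longrightarrow> (\<And>i. i \<in> I \<Longrightarrow> F i x \<le> y) \<Longrightarrow> upper_envelope F I x \<le> y"
  by (simp add: upper_envelope_def)

lemma convex_on_max:
  assumes "convex_on U f" "convex_on U g"
  shows "convex_on U (\<lambda>x. max (f x) (g x))"
  unfolding convex_on_def
proof (intro conjI ballI allI impI)
  show "convex U" using assms(1) by (simp add: convex_on_def)
  fix x y and u v :: real
  assume xy: "x \<in> U" "y \<in> U" and uv: "0 \<le> u" "0 \<le> v" "u + v = 1"
  have "f (u *\<^sub>R x + v *\<^sub>R y) \<le> u * f x + v * f y" "g (u *\<^sub>R x + v *\<^sub>R y) \<le> u * g x + v * g y"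
    using assms xy uv by (auto simp: convex_on_def)
  moreover have "u * f x + v * f y \<le> u * max (f x) (g x) + v * max (f y) (g y)"
    "u * g x + v * g y \<le> u * max (f x) (g x) + v * max (f y) (g y)"
    using uv by (auto intro!: add_mono mult_left_mono)
  ultimately show "max (f (u *\<^sub>R x + v *\<^sub>R y)) (g (u *\<^sub>R x + v *\<^sub>R y))
      \<le> u * max (f x) (g x) + v * max (f y) (g y)"
    by linarith
qed

lemma convex_on_upper_envelope:
  assumes "finite I" "I \<noteq> {}" "\<And>i. i \<in> I \<Longrightarrow> convex_on U (F i)"
  shows "convex_on U (upper_envelope F I)"
  using assms
proof (induction I rule: finite_ne_induct)
  case (singleton i)
  then show ?case by (simp add: upper_envelope_def[abs_def])
next
  case (insert i I)
  then have "convex_on U (\<lambda>x. max (F i x) (upper_envelope F I x))"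
    by (intro convex_on_max) auto
  moreover have "upper_envelope F (insert i I) = (\<lambda>x. max (F i x) (upper_envelope F I x))"
    using insert.hyps by (intro ext upper_envelope_insert)
  ultimately show ?case by simp
qed

lemma affine_fun_cmul: "affine_fun l \<Longrightarrow> affine_fun (\<lambda>x. c * l x)"
  unfolding affine_fun_def
proof (elim exE conjE)
  fix L d assume "linear L" and l: "\<forall>x. l x = L x + d"
  then have "linear (\<lambda>x. c * L x)"
    using linear_compose_scale_right[of L c] by simp
  then show "\<exists>L d. linear L \<and> (\<forall>x. c * l x = L x + d)"
    using l by (intro exI[of _ "\<lambda>x. c * L x"] exI[of _ "c * d"]) (simp add: algebra_simps)
qed

lemma convex_on_affine_fun: "convex U \<Longrightarrow> affine_fun l \<Longrightarrow> convex_on U l"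
  unfolding affine_fun_def
proof (elim exE conjE)
  fix L c assume U: "convex U" and L: "linear L" and l: "\<forall>x. l x = L x + c"
  have "l (u *\<^sub>R x + v *\<^sub>R y) = u * l x + v * l y" if "u + v = 1" for u v x y
  proof -
    have "l (u *\<^sub>R x + v *\<^sub>R y) = u * L x + v * L y + (u + v) * c"
      using L l that by (simp add: linear_add linear_scale)
    then show ?thesis using l by (simp add: algebra_simps)
  qed
  then show "convex_on U l" using U by (simp add: convex_on_def)
qed

section \<open>The valuation property and the dissection of a dilated simplex\<close>

lemma valuationD:
  assumes "is_valuation U \<mu>" "convex_on U f" "convex_on U g" "convex_on U h"
    "\<And>x. min (f x) (g x) = h x"
  shows "\<mu> (\<lambda>x. max (f x) (g x)) = \<mu> f + \<mu> g - \<mu> h"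
proof -
  have "(\<lambda>x. min (f x) (g x)) = h" using assms(5) by auto
  then have "\<mu> (\<lambda>x. max (f x) (g x)) + \<mu> h = \<mu> f + \<mu> g"
    using assms(1-4) unfolding is_valuation_def by metis
  then show ?thesis by (simp add: algebra_simps)
qed

text \<open>\<open>t * A i + u * B i\<close> is the support function of the tile \<open>{x\<^sub>i \<ge> u \<ge> x\<^sub>i\<^sub>+\<^sub>1}\<close> of the
  simplex \<open>{t + u \<ge> x\<^sub>1 \<ge> \<dots> \<ge> x\<^sub>m \<ge> 0}\<close>. Consecutive tiles meet in a common face.\<close>

lemma dissection_min:
  fixes s :: "nat \<Rightarrow> real" and t u :: real and m :: nat
  defines "A j \<equiv> Max (s ` {..j})" and "B j \<equiv> Max (s ` {j..m})"
  assumes "t \<ge> 0" "u \<ge> 0" "j < m"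
  shows "min (Max ((\<lambda>i. t * A i + u * B i) ` {..j})) (t * A (Suc j) + u * B (Suc j))
    = t * A j + u * B (Suc j)"
proof -
  let ?p = "\<lambda>i. t * A i + u * B i"
  have A_mono: "A i \<le> A k" if "i \<le> k" for i k
    unfolding A_def using that by (intro Max_mono) auto
  have B_mono: "B k \<le> B i" if "i \<le> k" "k \<le> m" for i k
    unfolding B_def using that by (intro Max_mono) auto
  have "A (Suc j) = max (s (Suc j)) (A j)"
    unfolding A_def by (simp add: atMost_Suc)
  have le: "t * A j + u * B (Suc j) \<le> ?p (Suc j)" "t * A j + u * B (Suc j) \<le> ?p j"
    using A_mono[of j "Suc j"] B_mono[of j "Suc j"] assms(3-5)
    by (auto intro: add_mono mult_left_mono)
  have le': "t * A j + u * B (Suc j) \<le> Max (?p ` {..j})"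
    using le(2) by (rule order_trans) (intro Max_ge; simp)
  \<comment> \<open>If \<open>s (Suc j)\<close> does not exceed the running maximum
    \<open>A j\<close>, then \<open>A (Suc j) = A j\<close> and the new tile attains the asserted
    minimum. Otherwise it dominates all earlier values, so \<open>B i \<le> B (Suc j)\<close> for
    \<open>i \<le> j\<close>, and the earlier tiles attain it.\<close>
  show ?thesis
  proof (cases "s (Suc j) \<le> A j")
    case True
    then have "A (Suc j) = A j"
      using \<open>A (Suc j) = _\<close> by simp
    then show ?thesis using le' by simp
  next
    case False
    have "B i \<le> B (Suc j)" if "i \<le> j" for i
      unfolding B_def[of i]
    proof (rule Max.boundedI)
      fix y assume "y \<in> s ` {i..m}"
      then obtain k where k: "k \<in> {i..m}" "y = s k" by auto
      show "y \<le> B (Suc j)"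
      proof (cases "k \<le> j")
        case True
        have "y \<le> A j" unfolding A_def using True k by (intro Max_ge) auto
        also have "\<dots> \<le> s (Suc j)" using False by simp
        also have "\<dots> \<le> B (Suc j)" unfolding B_def using assms(5) by (intro Max_ge) auto
        finally show ?thesis .
      next
        case False
        then show ?thesis unfolding B_def k using k by (intro Max_ge) auto
      qed
    qed (use that assms(5) in auto)
    then have "Max (?p ` {..j}) \<le> t * A j + u * B (Suc j)"
      using A_mono assms(3,4) by (auto intro!: add_mono mult_left_mono)
    then show ?thesis using le le' by linarith
  qed
qed

text \<open>The tiles fill the dilated simplex: an index \<open>i\<close> where \<open>s\<close> is
  maximal has \<open>A i = B i = A m\<close>, so its tile alone attains the value, and no tile
  exceeds it.\<close>

lemma dissection_max:
  fixes s :: "nat \<Rightarrow> real" and t u :: real and m :: nat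
  defines "A j \<equiv> Max (s ` {..j})" and "B j \<equiv> Max (s ` {j..m})"
  assumes "t \<ge> 0" "u \<ge> 0"
  shows "Max ((\<lambda>i. t * A i + u * B i) ` {..m}) = (t + u) * A m"
proof (rule antisym)
  have A_mono: "A i \<le> A m" if "i \<le> m" for i
    unfolding A_def using that by (intro Max_mono) auto
  have BA: "B i \<le> A m" if "i \<le> m" for i
    unfolding A_def B_def using that by (intro Max_mono) auto
  show "Max ((\<lambda>i. t * A i + u * B i) ` {..m}) \<le> (t + u) * A m"
    using A_mono BA assms(3,4) by (auto simp: distrib_right intro!: add_mono mult_left_mono)
  have "A m \<in> s ` {..m}" unfolding A_def by (rule Max_in) auto
  then obtain i where i: "i \<le> m" "A m = s i" by auto
  then have "A m \<le> A i" "A m \<le> B i"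
    unfolding A_def[of i] B_def[of i] by auto
  then have "(t + u) * A m \<le> t * A i + u * B i"
    using assms(3,4) by (auto simp: distrib_right intro!: add_mono mult_left_mono)
  then show "(t + u) * A m \<le> Max ((\<lambda>i. t * A i + u * B i) ` {..m})"
    using i by (subst Max_ge_iff) auto
qed

text \<open>Tiles are added one at a time. The new tile meets the union of the earlier ones in the
  face \<open>t * A j + u * B (Suc j)\<close>, which is convex, so each addition is one use of the
  valuation property. The summand \<open>g\<close> is carried along because the induction on the
  simplex needs an arbitrary base function.\<close>

lemma valuation_dissection:
  fixes \<mu> :: "('a::euclidean_space \<Rightarrow> real) \<Rightarrow> 'b::real_vector" and \<sigma> :: "nat \<Rightarrow> 'a \<Rightarrow> real" and m :: nat
  assumes \<mu>: "is_valuation U \<mu>" and g: "convex_on U g" and \<sigma>: "\<And>i. convex_on U (\<sigma> i)"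
    and "t \<ge> 0" "u \<ge> 0"
  defines "A \<equiv> \<lambda>j. upper_envelope \<sigma> {..j}" and "B \<equiv> \<lambda>j. upper_envelope \<sigma> {j..m}"
  shows "\<mu> (\<lambda>x. g x + (t + u) * A m x) = \<mu> (\<lambda>x. g x + (t * A 0 x + u * B 0 x))
    + (\<Sum>j<m. \<mu> (\<lambda>x. g x + (t * A (Suc j) x + u * B (Suc j) x))
              - \<mu> (\<lambda>x. g x + (t * A j x + u * B (Suc j) x)))"
proof -
  define p where "p i x = t * A i x + u * B i x" for i x
  have A: "convex_on U (A j)" for j
    unfolding A_def using \<sigma> by (intro convex_on_upper_envelope) auto
  have B: "convex_on U (B j)" if "j \<le> m" for j
    unfolding B_def using \<sigma> that by (intro convex_on_upper_envelope) auto
  have AB: "convex_on U (\<lambda>x. t * A i x + u * B j x)" if "j \<le> m" for i j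
    using A B[OF that] assms(4,5) by (intro convex_on_add convex_on_cmul) auto
  have p: "convex_on U (p i)" if "i \<le> m" for i
    unfolding p_def using AB that by auto
  have "\<mu> (\<lambda>x. g x + upper_envelope p {..k} x) = \<mu> (\<lambda>x. g x + p 0 x)
    + (\<Sum>j<k. \<mu> (\<lambda>x. g x + p (Suc j) x) - \<mu> (\<lambda>x. g x + (t * A j x + u * B (Suc j) x)))"
    if "k \<le> m" for k
    using that
  proof (induction k)
    case 0
    then show ?case by (simp add: upper_envelope_def)
  next
    case (Suc k)
    have q: "convex_on U (upper_envelope p {..k})"
      using Suc.prems p by (intro convex_on_upper_envelope) auto
    have "min (g x + p (Suc k) x) (g x + upper_envelope p {..k} x)
        = g x + (t * A k x + u * B (Suc k) x)" for x
      using dissection_min[OF assms(4,5), where j = k and s = "\<lambda>i. \<sigma> i x" and m = m] Suc.prems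
      unfolding p_def upper_envelope_def A_def B_def by simp
    then have "\<mu> (\<lambda>x. max (g x + p (Suc k) x) (g x + upper_envelope p {..k} x))
      = \<mu> (\<lambda>x. g x + p (Suc k) x) + \<mu> (\<lambda>x. g x + upper_envelope p {..k} x)
        - \<mu> (\<lambda>x. g x + (t * A k x + u * B (Suc k) x))"
      using Suc.prems by (intro valuationD[OF \<mu>] convex_on_add g p q AB) auto
    moreover have "(\<lambda>x. g x + upper_envelope p {..Suc k} x)
      = (\<lambda>x. max (g x + p (Suc k) x) (g x + upper_envelope p {..k} x))"
      by (simp add: atMost_Suc upper_envelope_insert max_add_distrib_right)
    ultimately show ?case using Suc by simp
  qed
  from this[of m] have "\<mu> (\<lambda>x. g x + upper_envelope p {..m} x) = \<mu> (\<lambda>x. g x + p 0 x)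
    + (\<Sum>j<m. \<mu> (\<lambda>x. g x + p (Suc j) x) - \<mu> (\<lambda>x. g x + (t * A j x + u * B (Suc j) x)))"
    by simp
  moreover have "upper_envelope p {..m} x = (t + u) * A m x" for x
    using dissection_max[OF assms(4,5), where s = "\<lambda>i. \<sigma> i x" and m = m]
    unfolding p_def upper_envelope_def A_def B_def by simp
  ultimately show ?thesis by (simp add: p_def)
qed

text \<open>Induction on \<open>m\<close>. Tiles and faces of index \<open>j < m\<close> involve
  \<open>t\<close> only through a maximum of \<open>j + 1\<close> functions and fall under the
  induction hypothesis once their multiple of \<open>u\<close> is absorbed into \<open>g\<close>. In
  tile \<open>m\<close> the part \<open>B m = \<sigma> m\<close> is affine and drops out by
  invariance, so this tile cancels against the subtracted \<open>\<mu> (g + t A m)\<close>.\<close>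

lemma differences_vanish_simplex:
  fixes \<mu> :: "('a::euclidean_space \<Rightarrow> real) \<Rightarrow> 'b::real_vector" and \<sigma> :: "nat \<Rightarrow> 'a \<Rightarrow> real" and m :: nat
  assumes U: "convex U" and \<mu>: "is_valuation U \<mu>" "dually_epi_translation_invariant U \<mu>"
    and \<sigma>: "\<And>i. affine_fun (\<sigma> i)" and "convex_on U g"
  shows "differences_vanish (Suc m) (\<lambda>t. \<mu> (\<lambda>x. g x + t * upper_envelope \<sigma> {..m} x))"
  using assms(5)
proof (induction m arbitrary: g rule: less_induct)
  case (less m)
  let ?A = "\<lambda>j. upper_envelope \<sigma> {..j}" and ?B = "\<lambda>j. upper_envelope \<sigma> {j..m}"
  have inv: "\<mu> (\<lambda>x. f x + t * \<sigma> i x) = \<mu> f" if "convex_on U f" for f t i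
    using \<mu>(2) that affine_fun_cmul[OF \<sigma>] unfolding dually_epi_translation_invariant_def by blast
  have \<sigma>': "convex_on U (\<sigma> i)" for i
    using \<sigma> U by (rule convex_on_affine_fun[rotated])
  have A0: "?A 0 = \<sigma> 0" and Bm: "?B m = \<sigma> m"
    by (auto simp: upper_envelope_def)
  have A: "convex_on U (?A j)" for j
    using \<sigma>' by (intro convex_on_upper_envelope) auto
  have B: "convex_on U (?B j)" if "j \<le> m" for j
    using \<sigma>' that by (intro convex_on_upper_envelope) auto
  show ?case
    unfolding differences_vanish.simps
  proof (intro allI impI)
    fix u :: real assume u: "u \<ge> 0"
    have gB: "convex_on U (\<lambda>x. g x + u * ?B j x)" if "j \<le> m" for j
      using B[OF that] less.prems u by (intro convex_on_add convex_on_cmul)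
    define \<psi> where "\<psi> i j t = \<mu> (\<lambda>x. (g x + u * ?B j x) + t * ?A i x)" for i j t
    have \<psi>: "differences_vanish m (\<psi> i j)" if "i < m" "j \<le> m" for i j
      unfolding \<psi>_def using less.IH[OF that(1) gB[OF that(2)]] Suc_leI[OF that(1)]
      by (intro differences_vanish_mono[of "Suc i" m])
    show "differences_vanish m
      (\<lambda>t. \<mu> (\<lambda>x. g x + (t + u) * ?A m x) - \<mu> (\<lambda>x. g x + t * ?A m x))"
    proof (cases m)
      \<comment> \<open>Here tile \<open>0\<close> is also the last one and there is no smaller
        case; invariance makes the function constant in \<open>t\<close>.\<close>
      case 0
      have "\<mu> (\<lambda>x. g x + t * ?A m x) = \<mu> g" for t
        using inv[OF less.prems] 0 A0 by simp
      then show ?thesis using 0 by simp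
    next
      case (Suc k)
      have "differences_vanish m (\<lambda>t. \<psi> 0 0 t + ((\<Sum>j<k. \<psi> (Suc j) (Suc j) t) - (\<Sum>j<m. \<psi> j (Suc j) t)))"
        by (intro differences_vanish_add differences_vanish_diff differences_vanish_sum \<psi>)
           (use Suc in auto)
      then show ?thesis
      proof (rule differences_vanish_cong)
        fix t :: real assume t: "t \<ge> 0"
        have "\<mu> (\<lambda>x. g x + (t + u) * ?A m x)
            = \<psi> 0 0 t + (\<Sum>j<m. \<psi> (Suc j) (Suc j) t - \<psi> j (Suc j) t)"
          using valuation_dissection[OF \<mu>(1) less.prems \<sigma>' t u, where m = m]
          unfolding \<psi>_def by (simp add: algebra_simps)
        also have "(\<Sum>j<m. \<psi> (Suc j) (Suc j) t - \<psi> j (Suc j) t)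
            = (\<Sum>j<k. \<psi> (Suc j) (Suc j) t) + \<psi> m m t - (\<Sum>j<m. \<psi> j (Suc j) t)"
          by (simp add: sum_subtractf Suc)
        also have "\<psi> m m t = \<mu> (\<lambda>x. (g x + t * ?A m x) + u * \<sigma> m x)"
          unfolding \<psi>_def Bm by (simp add: algebra_simps)
        also have "\<dots> = \<mu> (\<lambda>x. g x + t * ?A m x)"
          using A less.prems t by (intro inv convex_on_add convex_on_cmul)
        finally show "\<mu> (\<lambda>x. g x + (t + u) * ?A m x) - \<mu> (\<lambda>x. g x + t * ?A m x)
          = \<psi> 0 0 t + ((\<Sum>j<k. \<psi> (Suc j) (Suc j) t) - (\<Sum>j<m. \<psi> j (Suc j) t))"
          by simp
      qed
    qed
  qed
qed

section \<open>Reduction to at most \<open>n + 1\<close> affine functions\<close>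

text \<open>Unfolded, this is the sum over the sublists \<open>S\<close> of \<open>Ls\<close> of
  \<open>\<mu>\<close> at the maximum of \<open>g\<close> and \<open>S\<close>, with sign
  \<open>(-1) ^ (length Ls - length S)\<close>. The leading term uses all functions, so the
  vanishing of the sum expresses it through maxima of fewer functions.\<close>

fun alternating_difference ::
  "(('a \<Rightarrow> real) \<Rightarrow> 'b::ab_group_add) \<Rightarrow> ('a \<Rightarrow> real) list \<Rightarrow> ('a \<Rightarrow> real) \<Rightarrow> 'b" where
  "alternating_difference \<mu> [] g = \<mu> g"
| "alternating_difference \<mu> (L # Ls) g =
     alternating_difference \<mu> Ls (\<lambda>x. max (g x) (L x)) - alternating_difference \<mu> Ls g"

text \<open>Taking the maximum with \<open>L\<close> distributes over \<open>max\<close> and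
  \<open>min\<close> and preserves convexity, so precomposing a valuation with it gives a valuation;
  so does taking differences.\<close>

lemma is_valuation_alternating_difference:
  assumes "is_valuation U \<mu>" "\<And>L. L \<in> set Ls \<Longrightarrow> convex_on U L"
  shows "is_valuation U (alternating_difference \<mu> Ls)"
  using assms(2)
proof (induction Ls)
  case Nil
  then show ?case using assms(1) by (simp add: is_valuation_def)
next
  case (Cons L Ls)
  let ?A = "alternating_difference \<mu> Ls"
  have val: "?A (\<lambda>x. max (f x) (g x)) + ?A (\<lambda>x. min (f x) (g x)) = ?A f + ?A g"
    if "convex_on U f" "convex_on U g" "convex_on U (\<lambda>x. min (f x) (g x))" for f g
    using Cons that unfolding is_valuation_def by simp
  show ?case
    unfolding is_valuation_def
  proof (intro allI impI, elim conjE)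
    fix f g assume fg: "convex_on U f" "convex_on U g" "convex_on U (\<lambda>x. min (f x) (g x))"
    have L: "convex_on U L" using Cons.prems by simp
    have eq: "max (max (f x) (g x)) (L x) = max (max (f x) (L x)) (max (g x) (L x))"
      "max (min (f x) (g x)) (L x) = min (max (f x) (L x)) (max (g x) (L x))" for x
      by linarith+
    have "convex_on U (\<lambda>x. min (max (f x) (L x)) (max (g x) (L x)))"
      using convex_on_max[OF fg(3) L] by (simp only: eq)
    then have "?A (\<lambda>x. max (max (f x) (g x)) (L x)) + ?A (\<lambda>x. max (min (f x) (g x)) (L x))
      = ?A (\<lambda>x. max (f x) (L x)) + ?A (\<lambda>x. max (g x) (L x))"
      unfolding eq by (intro val convex_on_max fg L)
    then show "alternating_difference \<mu> (L # Ls) (\<lambda>x. max (f x) (g x))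
        + alternating_difference \<mu> (L # Ls) (\<lambda>x. min (f x) (g x))
      = alternating_difference \<mu> (L # Ls) f + alternating_difference \<mu> (L # Ls) g"
      using val[OF fg] by (simp add: algebra_simps)
  qed
qed

lemma min_le_convex_combination:
  fixes a b c d :: real
  assumes "c > 0" "d > 0"
  shows "min a b \<le> c / (c + d) * a + d / (c + d) * b"
    "c / (c + d) * a + d / (c + d) * b \<le> max a b"
proof -
  have "c / (c + d) + d / (c + d) = 1" using assms by (simp flip: add_divide_distrib)
  then have *: "c / (c + d) * y + d / (c + d) * y = y" for y
    by (metis distrib_right mult_1)
  have "c / (c + d) * min a b + d / (c + d) * min a b \<le> c / (c + d) * a + d / (c + d) * b"
    "c / (c + d) * a + d / (c + d) * b \<le> c / (c + d) * max a b + d / (c + d) * max a b"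
    using assms by (intro add_mono mult_left_mono; simp)+
  then show "min a b \<le> c / (c + d) * a + d / (c + d) * b"
    "c / (c + d) * a + d / (c + d) * b \<le> max a b"
    unfolding * .
qed

text \<open>The first two functions are traded for their weighted mean \<open>M\<close>: raising the base
  function to at least \<open>M\<close> changes nothing by the induction hypothesis, and above \<open>M\<close> the
  two functions satisfy \<open>min L\<^sub>1 L\<^sub>2 \<le> M\<close>, so the valuation property applies.\<close>

lemma alternating_difference_eq_0:
  assumes "is_valuation U \<mu>" "ws \<noteq> []" "\<And>c L. (c, L) \<in> set ws \<Longrightarrow> c > 0 \<and> convex_on U L"
    "convex_on U g" "\<And>x. (\<Sum>(c, L)\<leftarrow>ws. c * L x) \<le> (\<Sum>(c, L)\<leftarrow>ws. c) * g x"
  shows "alternating_difference \<mu> (map snd ws) g = 0"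
  using assms(2-)
proof (induction "length ws" arbitrary: ws g rule: less_induct)
  case less
  obtain c\<^sub>1 L\<^sub>1 rest where ws: "ws = (c\<^sub>1, L\<^sub>1) # rest"
    using less.prems(1) by (cases ws) auto
  have 1: "c\<^sub>1 > 0" "convex_on U L\<^sub>1" using less.prems(2)[of c\<^sub>1 L\<^sub>1] ws by auto
  show ?case
  proof (cases rest)
    case Nil
    then have "L\<^sub>1 x \<le> g x" for x using less.prems(4)[of x] ws 1 by simp
    then have "(\<lambda>x. max (g x) (L\<^sub>1 x)) = g" by (auto simp: max_def intro!: ext antisym)
    then show ?thesis using ws Nil by simp
  next
    case (Cons cL rs)
    obtain c\<^sub>2 L\<^sub>2 where rest: "rest = (c\<^sub>2, L\<^sub>2) # rs" using Cons by (cases cL) auto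
    have 2: "c\<^sub>2 > 0" "convex_on U L\<^sub>2" using less.prems(2)[of c\<^sub>2 L\<^sub>2] ws rest by auto
    define M where "M x = c\<^sub>1 / (c\<^sub>1 + c\<^sub>2) * L\<^sub>1 x + c\<^sub>2 / (c\<^sub>1 + c\<^sub>2) * L\<^sub>2 x" for x
    have M: "convex_on U M"
      unfolding M_def using 1 2 by (intro convex_on_add convex_on_cmul) auto
    have M_eq: "(c\<^sub>1 + c\<^sub>2) * M x = c\<^sub>1 * L\<^sub>1 x + c\<^sub>2 * L\<^sub>2 x" for x
    proof -
      have "c\<^sub>1 + c\<^sub>2 \<noteq> 0" using 1(1) 2(1) by simp
      then show ?thesis unfolding M_def by (simp add: distrib_left)
    qed
    have minM: "min (L\<^sub>1 x) (L\<^sub>2 x) \<le> M x" "M x \<le> max (L\<^sub>1 x) (L\<^sub>2 x)" for x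
      unfolding M_def by (intro min_le_convex_combination 1 2)+
    let ?A = "alternating_difference \<mu> (map snd rs)"
    have rs: "c > 0" "convex_on U L" if "(c, L) \<in> set rs" for c L
      using less.prems(2)[of c L] that ws rest by auto
    have nonneg: "(\<Sum>(c, L)\<leftarrow>rs. c) \<ge> 0"
      using rs(1) by (intro sum_list_nonneg) (auto intro: less_imp_le)
    \<comment> \<open>The induction hypothesis is used with
      \<open>(c\<^sub>1 + c\<^sub>2, M)\<close> in place of the first two pairs: weighted sum and
      total weight stay the same and the list is shorter. Any base \<open>h \<ge> g\<close> is
      admissible because the total weight is nonnegative.\<close>
    have drop: "?A (\<lambda>x. max (h x) (M x)) = ?A h" if h: "convex_on U h" "\<And>x. g x \<le> h x" for h
    proof -
      have "alternating_difference \<mu> (map snd ((c\<^sub>1 + c\<^sub>2, M) # rs)) h = 0"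
      proof (rule less.hyps)
        fix x
        have "(\<Sum>(c, L)\<leftarrow>(c\<^sub>1 + c\<^sub>2, M) # rs. c * L x) = (\<Sum>(c, L)\<leftarrow>ws. c * L x)"
          using M_eq[of x] ws rest by simp
        also have "\<dots> \<le> (\<Sum>(c, L)\<leftarrow>ws. c) * g x" by (rule less.prems(4))
        also have "\<dots> \<le> (\<Sum>(c, L)\<leftarrow>ws. c) * h x"
          using h(2)[of x] nonneg 1(1) 2(1) ws rest by (intro mult_left_mono) auto
        finally show "(\<Sum>(c, L)\<leftarrow>(c\<^sub>1 + c\<^sub>2, M) # rs. c * L x)
            \<le> (\<Sum>(c, L)\<leftarrow>(c\<^sub>1 + c\<^sub>2, M) # rs. c) * h x"
          using ws rest by (simp add: add.assoc)
      qed (use ws rest rs M h 1 2 in auto)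
      then show ?thesis by simp
    qed
    have val: "is_valuation U ?A"
      using rs(2) by (intro is_valuation_alternating_difference assms(1)) auto
    let ?g1 = "\<lambda>x. max (g x) (L\<^sub>1 x)" and ?g2 = "\<lambda>x. max (g x) (L\<^sub>2 x)" and ?gM = "\<lambda>x. max (g x) (M x)"
    \<comment> \<open>As \<open>M\<close> lies between \<open>min L\<^sub>1 L\<^sub>2\<close> and
      \<open>max L\<^sub>1 L\<^sub>2\<close>, the two arguments have minimum \<open>max g M\<close>,
      and \<open>M\<close> is absorbed in their maximum. Dropping \<open>M\<close> from the other
      three terms leaves the recursion unfolded twice.\<close>
    have "?A (\<lambda>x. max (max (?g1 x) (M x)) (max (?g2 x) (M x)))
        = ?A (\<lambda>x. max (?g1 x) (M x)) + ?A (\<lambda>x. max (?g2 x) (M x)) - ?A ?gM"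
    proof (rule valuationD[OF val])
      show "min (max (?g1 x) (M x)) (max (?g2 x) (M x)) = max (g x) (M x)" for x
        using minM(1)[of x] by linarith
    qed (intro convex_on_max less.prems(3) 1 2 M)+
    also have "(\<lambda>x. max (max (?g1 x) (M x)) (max (?g2 x) (M x))) = (\<lambda>x. max (?g1 x) (L\<^sub>2 x))"
    proof
      show "max (max (?g1 x) (M x)) (max (?g2 x) (M x)) = max (?g1 x) (L\<^sub>2 x)" for x
        using minM(2)[of x] by linarith
    qed
    finally have "?A (\<lambda>x. max (?g1 x) (L\<^sub>2 x)) = ?A ?g1 + ?A ?g2 - ?A g"
      using drop[of ?g1] drop[of ?g2] drop[of g]
        convex_on_max[OF less.prems(3) 1(2)] convex_on_max[OF less.prems(3) 2(2)] less.prems(3) by simp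
    then show ?thesis using ws rest by simp
  qed
qed

text \<open>The full sublist contributes \<open>\<psi> (Y \<union> set Ls)\<close>. Every other
  sublist yields a proper subset of this union, since \<open>Ls\<close> is distinct and disjoint
  from \<open>Y\<close>, and is covered by the assumption. The recursion moves the head of the list
  into \<open>Y\<close> or discards it.\<close>

lemma differences_vanish_alternating_difference:
  fixes \<mu> :: "('a \<Rightarrow> real) \<Rightarrow> 'b::real_vector"
  defines "\<psi> \<equiv> \<lambda>Z t. \<mu> (\<lambda>x. t * upper_envelope (\<lambda>l. l) Z x)"
  assumes "finite Y" "Y \<noteq> {}" "distinct Ls" "set Ls \<inter> Y = {}"
    and "\<And>Z. Y \<subseteq> Z \<Longrightarrow> Z \<subset> Y \<union> set Ls \<Longrightarrow> differences_vanish N (\<psi> Z)"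
  shows "differences_vanish N (\<lambda>t. alternating_difference (\<lambda>f. \<mu> (\<lambda>x. t * f x)) Ls
    (upper_envelope (\<lambda>l. l) Y) - \<psi> (Y \<union> set Ls) t)"
  using assms(2-)
proof (induction Ls arbitrary: Y)
  case Nil
  then show ?case by (simp add: \<psi>_def differences_vanish_zero)
next
  case (Cons L Ls)
  let ?A = "\<lambda>Y t. alternating_difference (\<lambda>f. \<mu> (\<lambda>x. t * f x)) Ls (upper_envelope (\<lambda>l. l) Y)"
  have ins: "upper_envelope (\<lambda>l. l) (insert L Y) = (\<lambda>x. max (upper_envelope (\<lambda>l. l) Y x) (L x))"
    using Cons.prems by (simp add: fun_eq_iff upper_envelope_insert max.commute)
  have "differences_vanish N (\<lambda>t. ?A (insert L Y) t - \<psi> (insert L Y \<union> set Ls) t)"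
    using Cons.prems by (intro Cons.IH) auto
  moreover have "differences_vanish N (\<lambda>t. ?A Y t - \<psi> (Y \<union> set Ls) t)"
    using Cons.prems by (intro Cons.IH) auto
  moreover have "differences_vanish N (\<psi> (Y \<union> set Ls))"
    using Cons.prems by (intro Cons.prems(5)) auto
  ultimately have "differences_vanish N (\<lambda>t. (?A (insert L Y) t - \<psi> (insert L Y \<union> set Ls) t)
      - ((?A Y t - \<psi> (Y \<union> set Ls) t) + \<psi> (Y \<union> set Ls) t))"
    by (rule differences_vanish_diff[OF _ differences_vanish_add])
  then show ?case
    by (rule differences_vanish_cong) (simp add: ins)
qed

section \<open>Affine functions and affine dependence of their gradients\<close>

lemma affine_fun_gradient:
  fixes l :: "'a::euclidean_space \<Rightarrow> real"
  assumes "affine_fun l"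
  shows "l x = (\<Sum>b\<in>Basis. (l b - l 0) *\<^sub>R b) \<bullet> x + l 0"
proof -
  obtain L c where L: "linear L" and l: "\<And>x. l x = L x + c"
    using assms unfolding affine_fun_def by blast
  have "L x = L (\<Sum>b\<in>Basis. (x \<bullet> b) *\<^sub>R b)" by (simp add: euclidean_representation)
  also have "\<dots> = (\<Sum>b\<in>Basis. (x \<bullet> b) * L b)"
    using L by (simp add: linear_sum linear_scale)
  also have "\<dots> = (\<Sum>b\<in>Basis. L b *\<^sub>R b) \<bullet> x"
    by (simp add: inner_sum_left inner_commute[of x] mult.commute)
  finally show ?thesis using linear_0[OF L] by (simp add: l)
qed

text \<open>So many gradients are affinely dependent. The dependency cancels the linear parts and
  leaves a constant \<open>\<kappa>\<close>, whose sign is adjusted by passing from \<open>c\<close>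
  to \<open>- c\<close>.\<close>

lemma affine_fun_dependent:
  fixes X :: "('a::euclidean_space \<Rightarrow> real) set"
  assumes "finite X" "card X \<ge> DIM('a) + 2" "\<And>l. l \<in> X \<Longrightarrow> affine_fun l"
  obtains c \<kappa> where "sum c X = 0" "\<exists>l\<in>X. c l \<noteq> 0" "\<And>x. (\<Sum>l\<in>X. c l * l x) = \<kappa>" "\<kappa> \<le> 0"
proof -
  define grad where "grad l = (\<Sum>b\<in>Basis. (l b - l 0) *\<^sub>R b)" for l :: "'a \<Rightarrow> real"
  have "\<exists>c. sum c X = 0 \<and> (\<exists>l\<in>X. c l \<noteq> 0) \<and> (\<Sum>l\<in>X. c l *\<^sub>R grad l) = 0"
  proof (cases "inj_on grad X")
    case True
    then have "card (grad ` X) \<ge> DIM('a) + 2" using assms(2) by (simp add: card_image)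
    then have "affine_dependent (grad ` X)"
      using assms(1) by (intro affine_dependent_biggerset) auto
    then obtain w where "sum w (grad ` X) = 0" "\<exists>v\<in>grad ` X. w v \<noteq> 0"
      "(\<Sum>v\<in>grad ` X. w v *\<^sub>R v) = 0"
      using affine_dependent_explicit_finite[of "grad ` X"] assms(1) by auto
    then show ?thesis
      by (intro exI[of _ "w \<circ> grad"]) (simp add: sum.reindex[OF True])
  next
    case False
    then obtain l m where lm: "l \<in> X" "m \<in> X" "l \<noteq> m" "grad l = grad m"
      unfolding inj_on_def by blast
    \<comment> \<open>Affine dependence concerns the set of gradients, in which coinciding ones
      merge; such a pair gives the weights \<open>1\<close> and \<open>-1\<close> directly.\<close>
    define c where "c k = (if k = l then 1 else 0) - (if k = m then 1 else 0 :: real)" for k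
    have "sum c X = 0" "(\<Sum>k\<in>X. c k *\<^sub>R grad k) = 0"
      unfolding c_def using lm assms(1)
      by (simp_all add: sum_subtractf scaleR_diff_left if_distribR if_distrib[of "\<lambda>r. r *\<^sub>R _"] cong: if_cong)
    moreover have "c l \<noteq> 0" unfolding c_def using lm by simp
    ultimately show ?thesis using lm(1) by blast
  qed
  then obtain c where c: "sum c X = 0" "\<exists>l\<in>X. c l \<noteq> 0" "(\<Sum>l\<in>X. c l *\<^sub>R grad l) = 0"
    by blast
  define \<kappa> where "\<kappa> = (\<Sum>l\<in>X. c l * l 0)"
  have \<kappa>: "(\<Sum>l\<in>X. c l * l x) = \<kappa>" for x
  proof -
    have "(\<Sum>l\<in>X. c l * l x) = (\<Sum>l\<in>X. c l * (grad l \<bullet> x) + c l * l 0)"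
    proof (intro sum.cong refl)
      fix l assume "l \<in> X"
      from affine_fun_gradient[OF assms(3)[OF this], of x]
      have "l x = grad l \<bullet> x + l 0" unfolding grad_def .
      then show "c l * l x = c l * (grad l \<bullet> x) + c l * l 0" by (simp add: algebra_simps)
    qed
    also have "\<dots> = (\<Sum>l\<in>X. c l *\<^sub>R grad l) \<bullet> x + \<kappa>"
      by (simp add: sum.distrib inner_sum_left \<kappa>_def)
    finally show ?thesis using c(3) by simp
  qed
  show ?thesis
  proof (cases "\<kappa> \<le> 0")
    case True
    then show ?thesis using that[of c \<kappa>] c \<kappa> by auto
  next
    case False
    then show ?thesis using that[of "\<lambda>l. - c l" "- \<kappa>"] c \<kappa> by (simp add: sum_negf)
  qed
qed

lemma is_valuation_scale:
  assumes "is_valuation U \<mu>" "t \<ge> 0"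
  shows "is_valuation U (\<lambda>f. \<mu> (\<lambda>x. t * f x))"
  unfolding is_valuation_def
proof (intro allI impI, elim conjE)
  fix f g assume fg: "convex_on U f" "convex_on U g" "convex_on U (\<lambda>x. min (f x) (g x))"
  have eq: "t * max (f x) (g x) = max (t * f x) (t * g x)"
    "t * min (f x) (g x) = min (t * f x) (t * g x)" for x
    using assms(2) by (simp_all add: max_mult_distrib_left min_mult_distrib_left)
  have "convex_on U (\<lambda>x. min (t * f x) (t * g x))"
    using convex_on_cmul[OF assms(2) fg(3)] by (simp only: eq)
  then show "\<mu> (\<lambda>x. t * max (f x) (g x)) + \<mu> (\<lambda>x. t * min (f x) (g x))
    = \<mu> (\<lambda>x. t * f x) + \<mu> (\<lambda>x. t * g x)"
    using assms fg unfolding eq is_valuation_def by (simp add: convex_on_cmul)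
qed

lemma differences_vanish_piecewise_affine:
  fixes \<mu> :: "('a::euclidean_space \<Rightarrow> real) \<Rightarrow> 'b::real_vector"
  assumes U: "convex U" and \<mu>: "is_valuation U \<mu>" "dually_epi_translation_invariant U \<mu>"
    and "finite X" "X \<noteq> {}" "\<And>l. l \<in> X \<Longrightarrow> affine_fun l"
  shows "differences_vanish (Suc DIM('a)) (\<lambda>t. \<mu> (\<lambda>x. t * upper_envelope (\<lambda>l. l) X x))"
  using assms(4-)
proof (induction "card X" arbitrary: X rule: less_induct)
  case less
  show ?case
  proof (cases "card X \<le> Suc DIM('a)")
    case True
    obtain h where h: "bij_betw h {0..<card X} X"
      using ex_bij_betw_nat_finite[OF less.prems(1)] by blast
    define m where "m = card X - 1"
    have "card X > 0" using less.prems by (simp add: card_gt_0_iff)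
    then have "{0..<card X} = {..m}" by (auto simp: m_def)
    then have hX: "h ` {..m} = X" using h by (simp add: bij_betw_def)
    \<comment> \<open>The simplex lemma asks every \<open>\<sigma> i\<close> to be affine, so
      indices beyond \<open>m\<close> repeat the last function.\<close>
    define \<sigma> where "\<sigma> i = h (min i m)" for i
    have "\<sigma> i \<in> X" for i unfolding \<sigma>_def using hX by auto
    then have "differences_vanish (Suc m) (\<lambda>t. \<mu> (\<lambda>x. 0 + t * upper_envelope \<sigma> {..m} x))"
      using less.prems(3) U \<mu> by (intro differences_vanish_simplex) (auto simp: convex_on_const)
    moreover have "upper_envelope \<sigma> {..m} = upper_envelope (\<lambda>l. l) X"
      unfolding upper_envelope_def \<sigma>_def hX[symmetric] image_image by (intro ext arg_cong[of _ _ Max] image_cong) auto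
    ultimately have "differences_vanish (Suc m) (\<lambda>t. \<mu> (\<lambda>x. t * upper_envelope (\<lambda>l. l) X x))"
      by (simp only: add_0)
    moreover have "Suc m \<le> Suc DIM('a)" using True by (simp add: m_def)
    ultimately show ?thesis by (rule differences_vanish_mono[rotated])
  next
    case False
    then obtain c \<kappa> where c: "sum c X = 0" "\<exists>l\<in>X. c l \<noteq> 0" "\<And>x. (\<Sum>l\<in>X. c l * l x) = \<kappa>" "\<kappa> \<le> 0"
      using affine_fun_dependent[OF less.prems(1) _ less.prems(3)] by auto
    \<comment> \<open>Weight zero goes to \<open>Y\<close>. Both parts are nonempty because the
      weights sum to zero without all vanishing.\<close>
    define I Y where "I = {l \<in> X. c l > 0}" and "Y = {l \<in> X. \<not> c l > 0}"
    have fin: "finite I" "finite Y" and X: "X = Y \<union> I" "Y \<inter> I = {}"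
      using less.prems(1) by (auto simp: I_def Y_def)
    have split: "sum f X = sum f Y + sum f I" for f :: "_ \<Rightarrow> real"
      unfolding X(1) using fin X(2) by (intro sum.union_disjoint)
    have "I \<noteq> {}"
    proof
      assume "I = {}"
      then have "\<forall>l\<in>X. - c l \<ge> 0" by (auto simp: I_def)
      then show False
        using c(1,2) less.prems(1) sum_nonneg_eq_0_iff[of X "\<lambda>l. - c l"] by (auto simp: sum_negf)
    qed
    have "Y \<noteq> {}"
    proof
      assume "Y = {}"
      then have "sum c X > 0"
        using X \<open>I \<noteq> {}\<close> fin by (auto intro!: sum_pos simp: I_def)
      then show False using c(1) by simp
    qed
    let ?g = "upper_envelope (\<lambda>l. l) Y"
    obtain Ls where Ls: "set Ls = I" "distinct Ls" using finite_distinct_list[OF fin(1)] by blast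
    \<comment> \<open>The domination required by \<open>alternating_difference_eq_0\<close>; the
      first inequality is where \<open>\<kappa> \<le> 0\<close> enters.\<close>
    have le: "(\<Sum>l\<in>I. c l * l x) \<le> (\<Sum>l\<in>I. c l) * ?g x" for x
    proof -
      have "(\<Sum>l\<in>I. c l * l x) \<le> (\<Sum>l\<in>Y. - c l * l x)"
        using split[of "\<lambda>l. c l * l x"] c(3)[of x] c(4) by (simp add: sum_negf)
      also have "\<dots> \<le> (\<Sum>l\<in>Y. - c l * ?g x)"
        using upper_envelope_ge[OF fin(2), of _ "\<lambda>l. l" x]
        by (intro sum_mono mult_left_mono) (auto simp: Y_def)
      also have "\<dots> = (\<Sum>l\<in>Y. - c l) * ?g x"
        by (simp only: sum_distrib_right)
      also have "(\<Sum>l\<in>Y. - c l) = (\<Sum>l\<in>I. c l)"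
        using split[of c] c(1) by (simp add: sum_negf)
      finally show ?thesis .
    qed
    have zero: "alternating_difference (\<lambda>f. \<mu> (\<lambda>x. t * f x)) Ls ?g = 0" if "t \<ge> 0" for t
    proof -
      let ?ws = "map (\<lambda>l. (c l, l)) Ls"
      have "alternating_difference (\<lambda>f. \<mu> (\<lambda>x. t * f x)) (map snd ?ws) ?g = 0"
      proof (rule alternating_difference_eq_0)
        show "is_valuation U (\<lambda>f. \<mu> (\<lambda>x. t * f x))" by (rule is_valuation_scale[OF \<mu>(1) that])
        show "?ws \<noteq> []" using \<open>I \<noteq> {}\<close> Ls by auto
        show "d > 0 \<and> convex_on U L" if "(d, L) \<in> set ?ws" for d L
          using that Ls less.prems(3) U by (auto simp: I_def intro: convex_on_affine_fun)
        show "convex_on U ?g"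
          using fin(2) \<open>Y \<noteq> {}\<close> less.prems(3) U
          by (intro convex_on_upper_envelope) (auto simp: Y_def intro: convex_on_affine_fun)
        show "(\<Sum>(d, L)\<leftarrow>?ws. d * L x) \<le> (\<Sum>(d, L)\<leftarrow>?ws. d) * ?g x" for x
          using le[of x] Ls by (simp add: o_def sum_list_distinct_conv_sum_set)
      qed
      then show ?thesis by (simp add: o_def)
    qed
    have "differences_vanish (Suc DIM('a)) (\<lambda>t. alternating_difference (\<lambda>f. \<mu> (\<lambda>x. t * f x)) Ls ?g
        - \<mu> (\<lambda>x. t * upper_envelope (\<lambda>l. l) (Y \<union> set Ls) x))"
    proof (rule differences_vanish_alternating_difference)
      fix Z assume Z: "Y \<subseteq> Z" "Z \<subset> Y \<union> set Ls"
      then have "Z \<subset> X" using X Ls by simp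
      then show "differences_vanish (Suc DIM('a)) (\<lambda>t. \<mu> (\<lambda>x. t * upper_envelope (\<lambda>l. l) Z x))"
        using Z(1) less.prems \<open>Y \<noteq> {}\<close> psubset_card_mono[OF less.prems(1)]
          finite_subset[OF psubset_imp_subset less.prems(1)]
        by (intro less.hyps) auto
    qed (use fin \<open>Y \<noteq> {}\<close> Ls X in auto)
    \<comment> \<open>For \<open>t \<ge> 0\<close> the alternating difference itself is zero, so
      after negation only the leading term remains.\<close>
    from differences_vanish_diff[OF differences_vanish_zero this]
    show ?thesis
    proof (rule differences_vanish_cong)
      fix t :: real assume "t \<ge> 0"
      then show "\<mu> (\<lambda>x. t * upper_envelope (\<lambda>l. l) X x) =
        0 - (alternating_difference (\<lambda>f. \<mu> (\<lambda>x. t * f x)) Ls ?g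
          - \<mu> (\<lambda>x. t * upper_envelope (\<lambda>l. l) (Y \<union> set Ls) x))"
        using zero Ls X(1) by simp
    qed
  qed
qed

section \<open>Continuity, density and the decomposition\<close>

text \<open>The neighbourhood filter of \<open>f\<close> for uniform convergence on compact subsets
  of \<open>U\<close>, traced on the convex functions. It turns continuity of \<open>\<mu>\<close>
  into \<open>tendsto\<close>, so that limits can be composed.\<close>

definition conv_nhds :: "'a::euclidean_space set \<Rightarrow> ('a \<Rightarrow> real) \<Rightarrow> ('a \<Rightarrow> real) filter" where
  "conv_nhds U f = (INF (K, e)\<in>{(K, e). compact K \<and> K \<subseteq> U \<and> 0 < e}.
     principal {g. convex_on U g \<and> (\<forall>x\<in>K. \<bar>g x - f x\<bar> < e)})"

lemma eventually_conv_nhds: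
  "eventually P (conv_nhds U f) \<longleftrightarrow> (\<exists>K e. compact K \<and> K \<subseteq> U \<and> e > 0 \<and>
     (\<forall>g. convex_on U g \<and> (\<forall>x\<in>K. \<bar>g x - f x\<bar> < e) \<longrightarrow> P g))"
proof -
  let ?B = "{(K, e::real). compact K \<and> K \<subseteq> U \<and> 0 < e}"
  let ?F = "\<lambda>(K, e). principal {g. convex_on U g \<and> (\<forall>x\<in>K. \<bar>g x - f x\<bar> < e)}"
  have "eventually P (INF b\<in>?B. ?F b) \<longleftrightarrow> (\<exists>b\<in>?B. eventually P (?F b))"
  proof (rule eventually_INF_base)
    show "?B \<noteq> {}" by (auto intro!: exI[of _ "{}"] exI[of _ 1])
    fix a b assume "a \<in> ?B" "b \<in> ?B"
    then obtain K e L d where "a = (K, e)" "b = (L, d)" "compact K" "K \<subseteq> U" "0 < e"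
      "compact L" "L \<subseteq> U" "0 < d" by auto
    then show "\<exists>x\<in>?B. ?F x \<le> inf (?F a) (?F b)"
      by (intro bexI[of _ "(K \<union> L, min e d)"]) auto
  qed
  then show ?thesis
    unfolding conv_nhds_def by (auto simp: eventually_principal)
qed

lemma conv_continuous_iff_tendsto:
  "conv_continuous U \<mu> \<longleftrightarrow> (\<forall>f. convex_on U f \<longrightarrow> (\<mu> \<longlongrightarrow> \<mu> f) (conv_nhds U f))"
  unfolding conv_continuous_def tendsto_def eventually_conv_nhds by blast

lemma filterlim_conv_nhds:
  fixes f :: "'a::euclidean_space \<Rightarrow> real"
  shows "filterlim X (conv_nhds U f) F \<longleftrightarrow> (\<forall>K e. compact K \<and> K \<subseteq> U \<and> e > 0 \<longrightarrow>
     (\<forall>\<^sub>F i in F. convex_on U (X i) \<and> (\<forall>x\<in>K. \<bar>X i x - f x\<bar> < e)))"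
  unfolding conv_nhds_def by (auto simp: filterlim_INF filterlim_principal)

lemma filterlim_conv_nhds_scale:
  fixes f :: "'a::euclidean_space \<Rightarrow> real"
  assumes "filterlim X (conv_nhds U f) F" "t \<ge> 0"
  shows "filterlim (\<lambda>i x. t * X i x) (conv_nhds U (\<lambda>x. t * f x)) F"
  unfolding filterlim_conv_nhds
proof (intro allI impI, elim conjE)
  fix K :: "'a set" and e :: real
  assume "compact K" "K \<subseteq> U" "e > 0"
  \<comment> \<open>\<open>t + 1\<close> instead of \<open>t\<close> keeps the denominator positive
    when \<open>t = 0\<close>.\<close>
  then have "\<forall>\<^sub>F i in F. convex_on U (X i) \<and> (\<forall>x\<in>K. \<bar>X i x - f x\<bar> < e / (t + 1))"
    using assms unfolding filterlim_conv_nhds by simp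
  then show "\<forall>\<^sub>F i in F. convex_on U (\<lambda>x. t * X i x) \<and> (\<forall>x\<in>K. \<bar>t * X i x - t * f x\<bar> < e)"
  proof eventually_elim
    case (elim i)
    have "\<bar>t * X i x - t * f x\<bar> < e" if "x \<in> K" for x
    proof -
      have "\<bar>t * X i x - t * f x\<bar> = t * \<bar>X i x - f x\<bar>"
        using assms(2) by (simp add: abs_mult flip: right_diff_distrib)
      also have "\<dots> \<le> (t + 1) * \<bar>X i x - f x\<bar>" by (intro mult_right_mono) auto
      also have "\<dots> < e" using elim that assms(2) by (simp add: field_simps)
      finally show ?thesis .
    qed
    then show ?case using elim assms(2) by (simp add: convex_on_cmul)
  qed
qed

text \<open>A convex function on an open set is continuous, hence bounded on each compact
  \<open>K\<close>, so its multiples converge uniformly there.\<close>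

lemma filterlim_conv_nhds_scalar:
  fixes f :: "'a::euclidean_space \<Rightarrow> real"
  assumes "open U" "convex_on U f" "(s \<longlongrightarrow> t) F" "\<And>i. s i \<ge> 0"
  shows "filterlim (\<lambda>i x. s i * f x) (conv_nhds U (\<lambda>x. t * f x)) F"
  unfolding filterlim_conv_nhds
proof (intro allI impI, elim conjE)
  fix K :: "'a set" and e :: real
  assume K: "compact K" "K \<subseteq> U" and e: "e > 0"
  have "continuous_on K f"
    using convex_on_continuous[OF assms(1,2)] K(2) continuous_on_subset by blast
  then have "bounded (f ` K)" using K(1) compact_continuous_image compact_imp_bounded by blast
  then obtain B where B: "B > 0" "\<And>x. x \<in> K \<Longrightarrow> \<bar>f x\<bar> \<le> B"
    unfolding bounded_pos by auto
  have "\<forall>\<^sub>F i in F. dist (s i) t < e / B"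
    using assms(3) e B(1) by (intro tendstoD) auto
  then show "\<forall>\<^sub>F i in F. convex_on U (\<lambda>x. s i * f x) \<and> (\<forall>x\<in>K. \<bar>s i * f x - t * f x\<bar> < e)"
  proof eventually_elim
    case (elim i)
    have "\<bar>s i * f x - t * f x\<bar> < e" if "x \<in> K" for x
    proof -
      have "\<bar>s i * f x - t * f x\<bar> = \<bar>s i - t\<bar> * \<bar>f x\<bar>"
        by (simp add: abs_mult flip: left_diff_distrib)
      also have "\<dots> \<le> \<bar>s i - t\<bar> * B" using B(2)[OF that] by (intro mult_left_mono) auto
      also have "\<dots> < e" using elim B(1) by (simp add: dist_real_def field_simps)
      finally show ?thesis .
    qed
    then show ?case using assms(2,4) by (simp add: convex_on_cmul)
  qed
qed

section \<open>Piecewise affine approximation of convex functions\<close>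

text \<open>A hyperplane separating \<open>(z, f z)\<close> from the strict epigraph
  \<open>?T\<close> yields the graph of \<open>l\<close>, provided it is not vertical, which
  openness of \<open>U\<close> guarantees.\<close>

lemma convex_on_supporting_affine:
  fixes f :: "'a::euclidean_space \<Rightarrow> real"
  assumes "open U" "convex_on U f" "z \<in> U"
  obtains l where "affine_fun l" "l z = f z" "\<And>x. x \<in> U \<Longrightarrow> l x \<le> f x"
proof -
  let ?T = "{(x, r). x \<in> U \<and> f x < r}"
  have U: "convex U" using assms(2) by (simp add: convex_on_def)
  have "convex ?T"
  proof (rule convexI)
    fix a b :: "'a \<times> real" and u v :: real
    assume ab: "a \<in> ?T" "b \<in> ?T" and uv: "0 \<le> u" "0 \<le> v" "u + v = 1"
    obtain x r y q where eq: "a = (x, r)" "b = (y, q)" by (cases a, cases b)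
    have "f (u *\<^sub>R x + v *\<^sub>R y) \<le> u * f x + v * f y"
      using assms(2) ab uv eq by (auto simp: convex_on_def)
    also have "\<dots> < u * r + v * q"
    proof (cases "u = 0")
      case True
      then show ?thesis using ab uv eq by auto
    next
      case False
      then have "u * f x < u * r" "v * f y \<le> v * q"
        using ab uv eq by (auto intro: mult_left_mono)
      then show ?thesis by linarith
    qed
    finally show "u *\<^sub>R a + v *\<^sub>R b \<in> ?T"
      using U ab uv eq by (auto simp: convex_def)
  qed
  moreover have "(z, f z + 1) \<in> ?T" using assms(3) by simp
  ultimately obtain a b where "a \<noteq> 0" "a \<bullet> (z, f z) \<le> b" "\<And>x. x \<in> ?T \<Longrightarrow> a \<bullet> x \<ge> b"
    using separating_hyperplane_sets[of "{(z, f z)}" ?T] by fastforce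
  moreover obtain p s where "a = (p, s)" by (cases a)
  ultimately have nz: "p \<noteq> 0 \<or> s \<noteq> 0"
    and sep: "\<And>x r. x \<in> U \<Longrightarrow> f x < r \<Longrightarrow> p \<bullet> z + s * f z \<le> p \<bullet> x + s * r"
    by (auto simp: zero_prod_def intro: order_trans)
  have "s \<ge> 0" using sep[of z "f z + 1"] assms(3) by (simp add: algebra_simps)
  moreover have "s \<noteq> 0"
  proof
    assume "s = 0"
    obtain d where d: "d > 0" "ball z d \<subseteq> U"
      using assms(1,3) open_contains_ball by blast
    have "p \<noteq> 0" using nz \<open>s = 0\<close> by simp
    \<comment> \<open>For a vertical hyperplane, \<open>p \<bullet> x\<close> would be minimal over
      \<open>U\<close> at \<open>z\<close>; a step of length \<open>d / 2\<close> from
      \<open>z\<close> against \<open>p\<close> stays in \<open>U\<close> and contradicts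
      this.\<close>
    define y where "y = z - (d / (2 * norm p)) *\<^sub>R p"
    have "y \<in> U" using d \<open>p \<noteq> 0\<close> by (auto simp: y_def dist_norm intro!: subsetD[OF d(2)])
    then have "p \<bullet> z \<le> p \<bullet> y" using sep[of y "f y + 1"] \<open>s = 0\<close> by simp
    then have "d / (2 * norm p) * (p \<bullet> p) \<le> 0" by (simp add: y_def inner_diff_right)
    moreover have "d / (2 * norm p) * (p \<bullet> p) > 0" using d \<open>p \<noteq> 0\<close> by simp
    ultimately show False by linarith
  qed
  ultimately have s: "s > 0" by simp
  define l where "l x = - (p \<bullet> x) / s + (p \<bullet> z / s + f z)" for x
  have "linear (\<lambda>x. - (p \<bullet> x) / s)"
    by (intro linearI) (simp_all add: inner_add_right add_divide_distrib diff_divide_distrib)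
  then have "affine_fun l"
    unfolding affine_fun_def l_def by blast
  moreover have "l z = f z" unfolding l_def by simp
  \<comment> \<open>Separation only speaks of values strictly above \<open>f x\<close>, hence the
    slack \<open>e\<close>.\<close>
  moreover have "l x \<le> f x" if "x \<in> U" for x
  proof (rule field_le_epsilon)
    fix e :: real assume "e > 0"
    then have "(p \<bullet> z + s * f z) / s \<le> (p \<bullet> x + s * (f x + e)) / s"
      using sep[OF that, of "f x + e"] s by (intro divide_right_mono) auto
    then show "l x \<le> f x + e"
      using s unfolding l_def by (simp add: add_divide_distrib)
  qed
  ultimately show ?thesis using that by blast
qed

text \<open>The affine support at \<open>z\<close> stays within \<open>e\<close> of \<open>f\<close>
  on the neighbourhood \<open>W z\<close>. Finitely many of these cover \<open>K\<close>, and the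
  maximum of their supports lies between \<open>f - e\<close> and \<open>f\<close> there.\<close>

lemma convex_on_piecewise_affine_approx:
  fixes f :: "'a::euclidean_space \<Rightarrow> real"
  assumes "open U" "convex_on U f" "compact K" "K \<subseteq> U" "e > 0"
  obtains X where "finite X" "X \<noteq> {}" "\<And>l. l \<in> X \<Longrightarrow> affine_fun l"
    "\<And>x. x \<in> K \<Longrightarrow> \<bar>upper_envelope (\<lambda>l. l) X x - f x\<bar> < e"
proof (cases "K = {}")
  case True
  have "affine_fun (\<lambda>x::'a. 0)"
    unfolding affine_fun_def by (intro exI[of _ "\<lambda>x. 0"] exI[of _ 0]) (simp add: linear_zero)
  then show ?thesis using True by (intro that[of "{\<lambda>x. 0}"]) auto
next
  case False
  have "\<forall>z\<in>U. \<exists>l. affine_fun l \<and> l z = f z \<and> (\<forall>x\<in>U. l x \<le> f x)"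
    using convex_on_supporting_affine[OF assms(1,2)] by metis
  then obtain l where l: "\<And>z. z \<in> U \<Longrightarrow> affine_fun (l z) \<and> l z z = f z \<and> (\<forall>x\<in>U. l z x \<le> f x)"
    by metis
  define W where "W z = {x \<in> U. f x - l z x < e}" for z
  have "open (W z)" if "z \<in> K" for z
  proof -
    have "convex_on U (l z)"
      using l[of z] that assms(2,4) by (intro convex_on_affine_fun) (auto simp: convex_on_def)
    then have "continuous_on U (\<lambda>x. f x - l z x)"
      by (intro continuous_on_diff convex_on_continuous assms(1,2))
    then have "open (U \<inter> (\<lambda>x. f x - l z x) -` {..<e})"
      using assms(1) by (intro continuous_open_preimage) auto
    moreover have "U \<inter> (\<lambda>x. f x - l z x) -` {..<e} = W z" by (auto simp: W_def)
    ultimately show ?thesis by simp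
  qed
  moreover have "K \<subseteq> (\<Union>z\<in>K. W z)"
    using l assms(4,5) by (fastforce simp: W_def)
  ultimately obtain C where C: "C \<subseteq> K" "finite C" "K \<subseteq> (\<Union>z\<in>C. W z)"
    using compactE_image[OF assms(3), of K W] by blast
  show ?thesis
  proof (rule that[of "l ` C"])
    show "finite (l ` C)" using C by simp
    show "l ` C \<noteq> {}" using C(3) False by auto
    show "affine_fun m" if "m \<in> l ` C" for m using that l C(1) assms(4) by auto
    fix x assume x: "x \<in> K"
    then obtain z where z: "z \<in> C" "x \<in> W z" using C(3) by blast
    have "upper_envelope (\<lambda>l. l) (l ` C) x \<le> f x"
    proof (rule upper_envelope_le)
      fix m assume "m \<in> l ` C"
      then obtain w where "w \<in> C" "m = l w" by blast
      then show "m x \<le> f x" using l[of w] C(1) x assms(4) by blast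
    qed (use C z in auto)
    moreover have "l z x \<le> upper_envelope (\<lambda>l. l) (l ` C) x"
      using upper_envelope_ge[of "l ` C" "l z" "\<lambda>l. l" x] C(2) z(1) by simp
    ultimately show "\<bar>upper_envelope (\<lambda>l. l) (l ` C) x - f x\<bar> < e"
      using z(2) by (simp add: W_def)
  qed
qed

text \<open>Approximating within \<open>1 / Suc i\<close> on the \<open>i\<close>-th set of a
  compact exhaustion makes one sequence serve all \<open>K\<close> and \<open>e\<close>.\<close>

lemma convex_on_piecewise_affine_sequence:
  fixes f :: "'a::euclidean_space \<Rightarrow> real"
  assumes "open U" "convex_on U f"
  obtains X :: "nat \<Rightarrow> ('a \<Rightarrow> real) set"
  where "\<And>i. finite (X i)" "\<And>i. X i \<noteq> {}" "\<And>i l. l \<in> X i \<Longrightarrow> affine_fun l"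
    "filterlim (\<lambda>i. upper_envelope (\<lambda>l. l) (X i)) (conv_nhds U f) sequentially"
proof -
  obtain C where C: "\<And>n::nat. compact (C n)" "\<And>n. C n \<subseteq> U"
    and exhaust: "\<And>K. \<lbrakk>compact K; K \<subseteq> U\<rbrakk> \<Longrightarrow> \<exists>N. \<forall>n\<ge>N. K \<subseteq> C n"
    using open_Union_compact_subsets[OF assms(1)] by metis
  have "\<exists>X. finite X \<and> X \<noteq> {} \<and> (\<forall>l\<in>X. affine_fun l) \<and>
      (\<forall>x\<in>C i. \<bar>upper_envelope (\<lambda>l. l) X x - f x\<bar> < 1 / real (Suc i))" for i
    by (rule convex_on_piecewise_affine_approx[OF assms C, of "1 / real (Suc i)" i]) auto
  then obtain X where X: "\<And>i. finite (X i)" "\<And>i. X i \<noteq> {}" "\<And>i l. l \<in> X i \<Longrightarrow> affine_fun l"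
    and approx: "\<And>i x. x \<in> C i \<Longrightarrow> \<bar>upper_envelope (\<lambda>l. l) (X i) x - f x\<bar> < 1 / real (Suc i)"
    by metis
  have "filterlim (\<lambda>i. upper_envelope (\<lambda>l. l) (X i)) (conv_nhds U f) sequentially"
    unfolding filterlim_conv_nhds
  proof (intro allI impI, elim conjE)
    fix K and e :: real assume K: "compact K" "K \<subseteq> U" and e: "e > 0"
    from exhaust[OF K] have "\<forall>\<^sub>F i in sequentially. K \<subseteq> C i"
      by (simp add: eventually_sequentially)
    moreover have "\<forall>\<^sub>F i in sequentially. 1 / real (Suc i) < e"
      using order_tendstoD(2)[OF lim_inverse_n' e] by (subst eventually_sequentially_Suc)
    ultimately show "\<forall>\<^sub>F i in sequentially. convex_on U (upper_envelope (\<lambda>l. l) (X i)) \<and>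
        (\<forall>x\<in>K. \<bar>upper_envelope (\<lambda>l. l) (X i) x - f x\<bar> < e)"
    proof eventually_elim
      case (elim i)
      have "convex_on U (upper_envelope (\<lambda>l. l) (X i))"
        using X assms(2)
        by (intro convex_on_upper_envelope convex_on_affine_fun) (auto simp: convex_on_def)
      then show ?case using approx[of _ i] elim by fastforce
    qed
  qed
  then show ?thesis using that X by blast
qed

section \<open>Limits in a topological vector space\<close>

text \<open>The classes \<open>real_vector\<close> and \<open>topological_space\<close> are not
  linked to each other, so limit rules come from the joint continuity in
  \<open>locally_convex_tvs\<close>.\<close>

lemma tvs_tendsto_add:
  fixes Fty :: "'b::{real_vector,topological_space} itself" and f g :: "'c \<Rightarrow> 'b"
  assumes "locally_convex_tvs Fty" "(f \<longlongrightarrow> a) F" "(g \<longlongrightarrow> b) F"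
  shows "((\<lambda>x. f x + g x) \<longlongrightarrow> a + b) F"
proof -
  have "continuous_on UNIV (\<lambda>(x::'b, y). x + y)"
    using assms(1) unfolding locally_convex_tvs_def by blast
  from continuous_on_tendsto_compose[OF this tendsto_Pair[OF assms(2,3)]]
  show ?thesis by simp
qed

lemma tvs_tendsto_scaleR:
  fixes Fty :: "'b::{real_vector,topological_space} itself" and g :: "'c \<Rightarrow> 'b"
  assumes "locally_convex_tvs Fty" "(s \<longlongrightarrow> r) F" "(g \<longlongrightarrow> b) F"
  shows "((\<lambda>x. s x *\<^sub>R g x) \<longlongrightarrow> r *\<^sub>R b) F"
proof -
  have "continuous_on UNIV (\<lambda>(t, x::'b). t *\<^sub>R x)"
    using assms(1) unfolding locally_convex_tvs_def by blast
  from continuous_on_tendsto_compose[OF this tendsto_Pair[OF assms(2,3)]]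
  show ?thesis by simp
qed

lemma tvs_tendsto_diff:
  fixes Fty :: "'b::{real_vector,topological_space} itself" and f g :: "'c \<Rightarrow> 'b"
  assumes "locally_convex_tvs Fty" "(f \<longlongrightarrow> a) F" "(g \<longlongrightarrow> b) F"
  shows "((\<lambda>x. f x - g x) \<longlongrightarrow> a - b) F"
  using tvs_tendsto_add[OF assms(1,2) tvs_tendsto_scaleR[OF assms(1) tendsto_const[of "-1"] assms(3)]]
  by simp

lemma tvs_tendsto_sum:
  fixes Fty :: "'b::{real_vector,topological_space} itself" and f :: "'i \<Rightarrow> 'c \<Rightarrow> 'b"
  assumes "locally_convex_tvs Fty" "\<And>i. i \<in> I \<Longrightarrow> (f i \<longlongrightarrow> a i) F"
  shows "((\<lambda>x. \<Sum>i\<in>I. f i x) \<longlongrightarrow> (\<Sum>i\<in>I. a i)) F"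
  using assms(2)
  by (induction I rule: infinite_finite_induct) (auto intro: tvs_tendsto_add[OF assms(1)])

text \<open>Vanishing differences are linear equations between finitely many values, so they pass to
  pointwise limits; the Hausdorff property makes the limit of zeros zero.\<close>

lemma differences_vanish_limit:
  fixes Fty :: "'b::{real_vector,t2_space} itself" and \<phi> :: "nat \<Rightarrow> real \<Rightarrow> 'b"
  assumes tvs: "locally_convex_tvs Fty" and "\<And>i. differences_vanish m (\<phi> i)"
    "\<And>t. t \<ge> 0 \<Longrightarrow> (\<lambda>i. \<phi> i t) \<longlonglongrightarrow> \<psi> t"
  shows "differences_vanish m \<psi>"
  using assms(2,3)
proof (induction m arbitrary: \<phi> \<psi>)
  case 0
  have "\<psi> t = 0" if "t \<ge> 0" for t
  proof (rule LIMSEQ_unique)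
    show "(\<lambda>i. \<phi> i t) \<longlonglongrightarrow> \<psi> t" by (rule 0(2)[OF that])
    have "(\<lambda>i. \<phi> i t) = (\<lambda>i. 0)" using 0(1) that by (intro ext) simp
    then show "(\<lambda>i. \<phi> i t) \<longlonglongrightarrow> 0" by simp
  qed
  then show ?case by simp
next
  case (Suc m)
  have "differences_vanish m (\<lambda>t. \<psi> (t + u) - \<psi> t)" if "u \<ge> 0" for u
  proof (rule Suc.IH)
    show "differences_vanish m (\<lambda>t. \<phi> i (t + u) - \<phi> i t)" for i
      using Suc.prems(1)[of i] that by simp
    show "(\<lambda>i. \<phi> i (t + u) - \<phi> i t) \<longlonglongrightarrow> \<psi> (t + u) - \<psi> t" if "t \<ge> 0" for t
      using that \<open>u \<ge> 0\<close> by (intro tvs_tendsto_diff[OF tvs] Suc.prems(2)) auto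
  qed
  then show ?case by simp
qed

section \<open>Polynomial behaviour of valuations under dilation\<close>

lemma differences_vanish_VConv:
  fixes Fty :: "'b::{real_vector,t2_space} itself" and \<mu> :: "('a::euclidean_space \<Rightarrow> real) \<Rightarrow> 'b"
  assumes "open U" "convex U" "locally_convex_tvs Fty" "\<mu> \<in> VConv U" "convex_on U f"
  shows "differences_vanish (Suc DIM('a)) (\<lambda>t. \<mu> (\<lambda>x. t * f x))"
proof -
  have \<mu>: "is_valuation U \<mu>" "conv_continuous U \<mu>" "dually_epi_translation_invariant U \<mu>"
    using assms(4) by (auto simp: VConv_def)
  obtain X where X: "\<And>i::nat. finite (X i)" "\<And>i. X i \<noteq> {}" "\<And>i l. l \<in> X i \<Longrightarrow> affine_fun l"
    and lim: "filterlim (\<lambda>i. upper_envelope (\<lambda>l. l) (X i)) (conv_nhds U f) sequentially"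
    using convex_on_piecewise_affine_sequence[OF assms(1,5)] by metis
  show ?thesis
  proof (rule differences_vanish_limit[OF assms(3)])
    show "differences_vanish (Suc DIM('a)) (\<lambda>t. \<mu> (\<lambda>x. t * upper_envelope (\<lambda>l. l) (X i) x))" for i
      by (rule differences_vanish_piecewise_affine[OF assms(2) \<mu>(1,3) X])
    fix t :: real assume t: "t \<ge> 0"
    have "(\<mu> \<longlongrightarrow> \<mu> (\<lambda>x. t * f x)) (conv_nhds U (\<lambda>x. t * f x))"
      using \<mu>(2) assms(5) t unfolding conv_continuous_iff_tendsto by (simp add: convex_on_cmul)
    from filterlim_compose[OF this filterlim_conv_nhds_scale[OF lim t]]
    show "(\<lambda>i. \<mu> (\<lambda>x. t * upper_envelope (\<lambda>l. l) (X i) x)) \<longlonglongrightarrow> \<mu> (\<lambda>x. t * f x)" .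
  qed
qed

lemma LIMSEQ_floor_fraction:
  fixes t :: real
  assumes "t \<ge> 0"
  shows "(\<lambda>i. real (nat \<lfloor>t * real (Suc i)\<rfloor>) / real (Suc i)) \<longlonglongrightarrow> t"
proof (rule LIMSEQ_I)
  fix e :: real assume "e > 0"
  then obtain N where N: "1 / real (Suc N) < e"
    using reals_Archimedean by (auto simp: inverse_eq_divide)
  have "norm (real (nat \<lfloor>t * real (Suc i)\<rfloor>) / real (Suc i) - t) < e" if "i \<ge> N" for i
  proof -
    have "\<bar>real (nat \<lfloor>t * real (Suc i)\<rfloor>) - t * real (Suc i)\<bar> \<le> 1"
      using assms by (simp add: of_nat_nat) linarith
    then have "\<bar>real (nat \<lfloor>t * real (Suc i)\<rfloor>) - t * real (Suc i)\<bar> / real (Suc i) \<le> 1 / real (Suc i)"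
      by (intro divide_right_mono) auto
    also have "\<bar>real (nat \<lfloor>t * real (Suc i)\<rfloor>) - t * real (Suc i)\<bar> / real (Suc i)
        = \<bar>real (nat \<lfloor>t * real (Suc i)\<rfloor>) / real (Suc i) - t\<bar>"
    proof -
      have "real (nat \<lfloor>t * real (Suc i)\<rfloor>) / real (Suc i) - t
          = (real (nat \<lfloor>t * real (Suc i)\<rfloor>) - t * real (Suc i)) / real (Suc i)"
        by (simp add: diff_divide_distrib del: of_nat_Suc)
      then show ?thesis by (simp add: abs_divide)
    qed
    also have "1 / real (Suc i) \<le> 1 / real (Suc N)"
      using that by (intro divide_left_mono) auto
    finally show ?thesis using N by simp
  qed
  then show "\<exists>N. \<forall>i\<ge>N. norm (real (nat \<lfloor>t * real (Suc i)\<rfloor>) / real (Suc i) - t) < e" by blast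
qed

text \<open>At rational \<open>t\<close> this is the Newton argument. The coefficients do not depend
  on the denominator and both sides are continuous in \<open>t\<close>, so the formula extends to
  real \<open>t\<close>.\<close>

lemma VConv_polynomial:
  fixes Fty :: "'b::{real_vector,t2_space} itself" and \<mu> :: "('a::euclidean_space \<Rightarrow> real) \<Rightarrow> 'b"
  assumes "open U" "convex U" and tvs: "locally_convex_tvs Fty" and "\<mu> \<in> VConv U" "convex_on U f" "t \<ge> 0"
    and a: "\<forall>i\<le>DIM('a). \<forall>k\<le>DIM('a). (\<Sum>j\<le>DIM('a). a k j * real j ^ i) = (if i = k then 1 else 0)"
  shows "\<mu> (\<lambda>x. t * f x) = (\<Sum>k\<le>DIM('a). t ^ k *\<^sub>R (\<Sum>j\<le>DIM('a). a k j *\<^sub>R \<mu> (\<lambda>x. real j * f x)))"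
proof -
  define d where "d k = (\<Sum>j\<le>DIM('a). a k j *\<^sub>R \<mu> (\<lambda>x. real j * f x))" for k
  define s where "s i = real (nat \<lfloor>t * real (Suc i)\<rfloor>) / real (Suc i)" for i
  have s: "s \<longlonglongrightarrow> t" unfolding s_def by (rule LIMSEQ_floor_fraction[OF assms(6)])
  have "(\<mu> \<longlongrightarrow> \<mu> (\<lambda>x. t * f x)) (conv_nhds U (\<lambda>x. t * f x))"
    using assms(4-6) unfolding VConv_def conv_continuous_iff_tendsto by (simp add: convex_on_cmul)
  moreover have "filterlim (\<lambda>i x. s i * f x) (conv_nhds U (\<lambda>x. t * f x)) sequentially"
    by (intro filterlim_conv_nhds_scalar assms(1,5) s) (simp add: s_def)
  ultimately have "(\<lambda>i. \<mu> (\<lambda>x. s i * f x)) \<longlonglongrightarrow> \<mu> (\<lambda>x. t * f x)"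
    by (rule filterlim_compose)
  moreover have "\<mu> (\<lambda>x. s i * f x) = (\<Sum>k\<le>DIM('a). s i ^ k *\<^sub>R d k)" for i
    unfolding s_def d_def
    by (rule differences_vanish_rational[OF a differences_vanish_VConv[OF assms(1-5)]]) simp
  moreover have "(\<lambda>i. \<Sum>k\<le>DIM('a). s i ^ k *\<^sub>R d k) \<longlonglongrightarrow> (\<Sum>k\<le>DIM('a). t ^ k *\<^sub>R d k)"
    by (intro tvs_tendsto_sum[OF tvs] tvs_tendsto_scaleR[OF tvs] tendsto_power s tendsto_const)
  ultimately show ?thesis
    unfolding d_def using LIMSEQ_unique by simp
qed

section \<open>Closure properties of \<open>VConv U\<close>\<close>

lemma VConv_zero: "(\<lambda>f. 0) \<in> VConv U"
  by (simp add: VConv_def is_valuation_def dually_epi_translation_invariant_def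
      conv_continuous_iff_tendsto)

lemma VConv_add:
  fixes Fty :: "'b::{real_vector,t2_space} itself" and \<mu> \<nu> :: "('a::euclidean_space \<Rightarrow> real) \<Rightarrow> 'b"
  assumes "locally_convex_tvs Fty" "\<mu> \<in> VConv U" "\<nu> \<in> VConv U"
  shows "(\<lambda>f. \<mu> f + \<nu> f) \<in> VConv U"
proof -
  have "conv_continuous U (\<lambda>f. \<mu> f + \<nu> f)"
    using assms(2,3) unfolding VConv_def conv_continuous_iff_tendsto
    by (auto intro: tvs_tendsto_add[OF assms(1)])
  moreover have "is_valuation U (\<lambda>f. \<mu> f + \<nu> f)"
    unfolding is_valuation_def
  proof (intro allI impI)
    fix f g :: "'a \<Rightarrow> real"
    assume "convex_on U f \<and> convex_on U g \<and> convex_on U (\<lambda>x. min (f x) (g x))"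
    then have "(\<mu> (\<lambda>x. max (f x) (g x)) + \<mu> (\<lambda>x. min (f x) (g x))) +
        (\<nu> (\<lambda>x. max (f x) (g x)) + \<nu> (\<lambda>x. min (f x) (g x))) = (\<mu> f + \<mu> g) + (\<nu> f + \<nu> g)"
      using assms(2,3) by (simp add: VConv_def is_valuation_def)
    then show "\<mu> (\<lambda>x. max (f x) (g x)) + \<nu> (\<lambda>x. max (f x) (g x)) +
        (\<mu> (\<lambda>x. min (f x) (g x)) + \<nu> (\<lambda>x. min (f x) (g x))) = \<mu> f + \<nu> f + (\<mu> g + \<nu> g)"
      by (simp only: add_ac)
  qed
  ultimately show ?thesis
    using assms(2,3) by (simp add: VConv_def dually_epi_translation_invariant_def)
qed

lemma VConv_scaleR:
  fixes Fty :: "'b::{real_vector,t2_space} itself" and \<mu> :: "('a::euclidean_space \<Rightarrow> real) \<Rightarrow> 'b"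
  assumes "locally_convex_tvs Fty" "\<mu> \<in> VConv U"
  shows "(\<lambda>f. r *\<^sub>R \<mu> f) \<in> VConv U"
proof -
  have "conv_continuous U (\<lambda>f. r *\<^sub>R \<mu> f)"
    using assms(2) unfolding VConv_def conv_continuous_iff_tendsto
    by (auto intro: tvs_tendsto_scaleR[OF assms(1)] tendsto_const)
  then show ?thesis
    using assms(2)
    by (simp add: VConv_def dually_epi_translation_invariant_def is_valuation_def flip: scaleR_add_right)
qed

lemma VConv_sum:
  fixes Fty :: "'b::{real_vector,t2_space} itself" and \<mu> :: "'i \<Rightarrow> ('a::euclidean_space \<Rightarrow> real) \<Rightarrow> 'b"
  assumes "locally_convex_tvs Fty" "\<And>i. i \<in> I \<Longrightarrow> \<mu> i \<in> VConv U"
  shows "(\<lambda>f. \<Sum>i\<in>I. \<mu> i f) \<in> VConv U"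
  using assms(2)
  by (induction I rule: infinite_finite_induct) (auto simp: VConv_zero intro: VConv_add[OF assms(1)])

text \<open>For \<open>t \<ge> 0\<close>, multiplication by \<open>t\<close> is continuous and
  respects convexity, \<open>max\<close>, \<open>min\<close> and affine functions, hence every
  condition in \<open>VConv\<close>.\<close>

lemma VConv_scale_argument:
  fixes \<mu> :: "('a::euclidean_space \<Rightarrow> real) \<Rightarrow> 'b::{real_vector,t2_space}"
  assumes "\<mu> \<in> VConv U" "t \<ge> 0"
  shows "(\<lambda>f. \<mu> (\<lambda>x. t * f x)) \<in> VConv U"
proof -
  have \<mu>: "is_valuation U \<mu>" "conv_continuous U \<mu>" "dually_epi_translation_invariant U \<mu>"
    using assms(1) by (auto simp: VConv_def)
  have "conv_continuous U (\<lambda>f. \<mu> (\<lambda>x. t * f x))"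
    unfolding conv_continuous_iff_tendsto
  proof (intro allI impI)
    fix f assume "convex_on U f"
    then have "(\<mu> \<longlongrightarrow> \<mu> (\<lambda>x. t * f x)) (conv_nhds U (\<lambda>x. t * f x))"
      using \<mu>(2) assms(2) unfolding conv_continuous_iff_tendsto by (simp add: convex_on_cmul)
    then show "((\<lambda>f. \<mu> (\<lambda>x. t * f x)) \<longlongrightarrow> \<mu> (\<lambda>x. t * f x)) (conv_nhds U f)"
      using filterlim_conv_nhds_scale[OF filterlim_ident assms(2)] by (rule filterlim_compose)
  qed
  moreover have "dually_epi_translation_invariant U (\<lambda>f. \<mu> (\<lambda>x. t * f x))"
    unfolding dually_epi_translation_invariant_def
  proof (intro allI impI, elim conjE)
    fix f l :: "'a \<Rightarrow> real" assume "convex_on U f" "affine_fun l"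
    then have "\<mu> (\<lambda>x. t * f x + t * l x) = \<mu> (\<lambda>x. t * f x)"
      using \<mu>(3) assms(2) affine_fun_cmul[of l t] convex_on_cmul[of t U f]
      unfolding dually_epi_translation_invariant_def by blast
    then show "\<mu> (\<lambda>x. t * (f x + l x)) = \<mu> (\<lambda>x. t * f x)" by (simp add: distrib_left)
  qed
  ultimately show ?thesis
    using is_valuation_scale[OF \<mu>(1) assms(2)] by (simp add: VConv_def)
qed

text \<open>The direct sum is spelled out as closure under sums, existence and uniqueness of
  components. Equalities are asked for functions convex on \<open>U\<close> only, since other
  arguments represent no point of the space.\<close>

theorem theorem3p2:
  fixes U :: "'a::euclidean_space set"
    and Fty :: "'b::{real_vector,t2_space} itself"
  assumes "open U" and "convex U"
    and "locally_convex_tvs Fty"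
  shows "(\<forall>\<nu> :: nat \<Rightarrow> ('a \<Rightarrow> real) \<Rightarrow> 'b. (\<forall>k\<le>DIM('a). \<nu> k \<in> VConv_hom U k) \<longrightarrow>
            (\<lambda>f. \<Sum>k\<le>DIM('a). \<nu> k f) \<in> VConv U)
       \<and> (\<forall>\<mu> \<in> (VConv U :: (('a \<Rightarrow> real) \<Rightarrow> 'b) set).
            \<exists>\<nu>. (\<forall>k\<le>DIM('a). \<nu> k \<in> VConv_hom U k) \<and>
                 (\<forall>f. convex_on U f \<longrightarrow> \<mu> f = (\<Sum>k\<le>DIM('a). \<nu> k f)))
       \<and> (\<forall>\<nu> \<nu>' :: nat \<Rightarrow> ('a \<Rightarrow> real) \<Rightarrow> 'b.
            (\<forall>k\<le>DIM('a). \<nu> k \<in> VConv_hom U k) \<and> (\<forall>k\<le>DIM('a). \<nu>' k \<in> VConv_hom U k) \<and>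
            (\<forall>f. convex_on U f \<longrightarrow> (\<Sum>k\<le>DIM('a). \<nu> k f) = (\<Sum>k\<le>DIM('a). \<nu>' k f)) \<longrightarrow>
            (\<forall>k\<le>DIM('a). \<forall>f. convex_on U f \<longrightarrow> \<nu> k f = \<nu>' k f))"
proof -
  obtain a where a: "\<forall>i\<le>DIM('a). \<forall>k\<le>DIM('a).
      (\<Sum>j\<le>DIM('a). a k j * real j ^ i) = (if i = k then 1 else 0)"
    using inverse_vandermonde by blast
  have sum: "(\<lambda>f. \<Sum>k\<le>DIM('a). \<nu> k f) \<in> VConv U"
    if "\<forall>k\<le>DIM('a). \<nu> k \<in> VConv_hom U k" for \<nu> :: "nat \<Rightarrow> ('a \<Rightarrow> real) \<Rightarrow> 'b"
    using that by (intro VConv_sum[OF assms(3)]) (auto simp: VConv_hom_def)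
  have decomposition: "\<exists>\<nu>. (\<forall>k\<le>DIM('a). \<nu> k \<in> VConv_hom U k) \<and>
      (\<forall>f. convex_on U f \<longrightarrow> \<mu> f = (\<Sum>k\<le>DIM('a). \<nu> k f))"
    if \<mu>: "\<mu> \<in> VConv U" for \<mu> :: "('a \<Rightarrow> real) \<Rightarrow> 'b"
  proof -
    \<comment> \<open>Row \<open>k\<close> of the inverse Vandermonde matrix extracts the
      coefficient of \<open>t ^ k\<close>; being a combination of dilates of \<open>\<mu>\<close>,
      \<open>\<nu> k\<close> stays in \<open>VConv U\<close>.\<close>
    define \<nu> where "\<nu> k f = (\<Sum>j\<le>DIM('a). a k j *\<^sub>R \<mu> (\<lambda>x. real j * f x))" for k f
    have poly: "\<mu> (\<lambda>x. t * f x) = (\<Sum>k\<le>DIM('a). t ^ k *\<^sub>R \<nu> k f)"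
      if "convex_on U f" "t \<ge> 0" for f t
      unfolding \<nu>_def by (rule VConv_polynomial[OF assms \<mu> that a])
    have "\<nu> k \<in> VConv_hom U k" if k: "k \<le> DIM('a)" for k
    proof -
      have "\<nu> k \<in> VConv U"
        unfolding \<nu>_def[abs_def]
        by (intro VConv_sum[OF assms(3)] VConv_scaleR[OF assms(3)] VConv_scale_argument[OF \<mu>]) simp
      moreover have "\<nu> k (\<lambda>x. t * f x) = t ^ k *\<^sub>R \<nu> k f" if "convex_on U f" "t \<ge> 0" for f t
      proof -
        \<comment> \<open>Dilation by \<open>j * t\<close> multiplies \<open>\<nu> i f\<close> by
          \<open>j ^ i * t ^ i\<close>, and row \<open>k\<close> of \<open>a\<close> isolates the
          term with \<open>i = k\<close>.\<close>
        have "\<mu> (\<lambda>x. real j * (t * f x)) = (\<Sum>i\<le>DIM('a). real j ^ i *\<^sub>R (t ^ i *\<^sub>R \<nu> i f))" for j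
          using poly[OF that(1), of "real j * t"] that(2) by (simp add: power_mult_distrib mult.assoc)
        then show ?thesis
          unfolding \<nu>_def[of k "\<lambda>x. t * f x"]
          using vandermonde_recover[OF a k] by (simp del: scaleR_scaleR)
      qed
      ultimately show ?thesis by (simp add: VConv_hom_def)
    qed
    moreover have "\<mu> f = (\<Sum>k\<le>DIM('a). \<nu> k f)" if "convex_on U f" for f
      using poly[OF that, of 1] by simp
    ultimately show ?thesis by blast
  qed
  \<comment> \<open>The right-hand side depends only on the sum of the components, evaluated at
    dilates of \<open>f\<close>; uniqueness follows.\<close>
  have recover: "\<nu> k f = (\<Sum>j\<le>DIM('a). a k j *\<^sub>R (\<Sum>i\<le>DIM('a). \<nu> i (\<lambda>x. real j * f x)))"
    if \<nu>: "\<forall>k\<le>DIM('a). \<nu> k \<in> VConv_hom U k" and k: "k \<le> DIM('a)" and f: "convex_on U f"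
    for \<nu> :: "nat \<Rightarrow> ('a \<Rightarrow> real) \<Rightarrow> 'b" and k f
  proof -
    have "(\<Sum>i\<le>DIM('a). \<nu> i (\<lambda>x. real j * f x)) = (\<Sum>i\<le>DIM('a). real j ^ i *\<^sub>R \<nu> i f)" for j
      using \<nu> f by (intro sum.cong refl) (auto simp: VConv_hom_def)
    then show ?thesis using vandermonde_recover[OF a k, of "\<lambda>i. \<nu> i f"] by simp
  qed
  have unique: "\<nu> k f = \<nu>' k f"
    if \<nu>: "\<forall>k\<le>DIM('a). \<nu> k \<in> VConv_hom U k" "\<forall>k\<le>DIM('a). \<nu>' k \<in> VConv_hom U k"
      and eq: "\<forall>f. convex_on U f \<longrightarrow> (\<Sum>k\<le>DIM('a). \<nu> k f) = (\<Sum>k\<le>DIM('a). \<nu>' k f)"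
      and k: "k \<le> DIM('a)" and f: "convex_on U f"
    for \<nu> \<nu>' :: "nat \<Rightarrow> ('a \<Rightarrow> real) \<Rightarrow> 'b" and k f
    unfolding recover[OF \<nu>(1) k f] recover[OF \<nu>(2) k f]
    using eq f by (intro sum.cong refl) (simp add: convex_on_cmul)
  show ?thesis
  proof (intro conjI allI ballI impI)
    fix \<nu> \<nu>' :: "nat \<Rightarrow> ('a \<Rightarrow> real) \<Rightarrow> 'b" and k f
    assume "(\<forall>k\<le>DIM('a). \<nu> k \<in> VConv_hom U k) \<and> (\<forall>k\<le>DIM('a). \<nu>' k \<in> VConv_hom U k) \<and>
        (\<forall>f. convex_on U f \<longrightarrow> (\<Sum>k\<le>DIM('a). \<nu> k f) = (\<Sum>k\<le>DIM('a). \<nu>' k f))"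
      and "k \<le> DIM('a)" "convex_on U f"
    then show "\<nu> k f = \<nu>' k f" by (elim conjE) (rule unique)
  qed (fact sum, fact decomposition)
qed

end
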